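(* Let $X$ be an amenable periodic graph with exhaustion $\{K_n\}$, and let $Y$ be a graph with the same vertices as $X$. Then $Y$ is a density zero perturbation of $X$ if and only if $$\lim_n\frac{|\{\{u,v\}\in EX\triangle EY:\ u\in VK_n\}|}{|VK_n|}=0,$$ where $EX\triangle EY$ denotes the symmetric difference. In this case, for every continuous function $\varphi$ on $\mathbb R$, $$\mathrm{Tr}_\Gamma(\varphi(A_X))=\mathrm{Tr}_\Gamma(\varphi(A_Y)).$$
   Context: Graphs are simple, countable and of bounded degree; $A_X$ is the adjacency operator on $\ell^2(VX)$. An amenable exhaustion of an infinite graph $X$ is an increasing exhaustion by finite subgraphs $K_n$ with $|\mathcal FK_n|/|VK_n|\to0$, where $\mathcal FK_n=\{v\in VK_n: d(v,VX\setminus VK_n)=1\}$; $P_n$ is the projection onto $\ell^2(VK_n)$. An amenable periodic graph is an infinite graph $X$ with a countable discrete amenable group $\Gamma$ of automorphisms acting freely with finite quotient, with fundamental domain $F\subset VX$ (a set of representatives of $VX/\Gamma$), and with an amenable exhaustion $K_n$ such that $VK_n\setminus\mathcal FK_n\subseteq E_nF\subseteq VK_n$ for suitable finite $E_n\subset\Gamma$. $Y$ is a density zero perturbation of $X$ if $A_X-A_Y$ is essentially zero; a positive operator $T$ is essentially zero if $\lim_n\mathrm{Tr}(TP_n)/|VK_n|=0$, and a self-adjoint operator $T$ is essentially zero if the positive operator $T^2$ is (i.e. $T$ belongs to the closed two-sided ideal, of the $C^*$-algebra generated by finite propagation operators, whose positive part consists of the positive essentially zero operators). The trace is $\mathrm{Tr}_\Gamma(T)=\lim_n\frac{\mathrm{Tr}(TP_n)}{|VK_n|}$;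 on $\Gamma$-invariant operators it equals $\frac1{|F|}\sum_{x\in F}T(x,x)$, and it vanishes on essentially zero operators. *)

theory Defs
  imports "HOL-Analysis.Analysis" "HOL-Computational_Algebra.Polynomial"
    "HOL-Algebra.Bij" "HOL-Algebra.Coset"
begin

section \<open>The Hilbert space of square-summable functions\<close>

lemma square_summable_add:
  fixes f g :: "'v \<Rightarrow> complex"
  assumes "(\<lambda>v. (cmod (f v))\<^sup>2) summable_on UNIV" "(\<lambda>v. (cmod (g v))\<^sup>2) summable_on UNIV"
  shows "(\<lambda>v. (cmod (f v + g v))\<^sup>2) summable_on UNIV"
proof (rule summable_on_comparison_test)
  show "(\<lambda>v. 2 * (cmod (f v))\<^sup>2 + 2 * (cmod (g v))\<^sup>2) summable_on UNIV"
    by (intro summable_on_add summable_on_cmult_right assms)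
  fix v
  have "(cmod (f v + g v))\<^sup>2 \<le> (cmod (f v) + cmod (g v))\<^sup>2"
    by (intro power_mono norm_triangle_ineq) auto
  also have "\<dots> \<le> 2 * (cmod (f v))\<^sup>2 + 2 * (cmod (g v))\<^sup>2"
    using sum_squares_bound[of "cmod (f v)" "cmod (g v)"] by (simp add: power2_sum)
  finally show "(cmod (f v + g v))\<^sup>2 \<le> 2 * (cmod (f v))\<^sup>2 + 2 * (cmod (g v))\<^sup>2" .
qed auto

lemma square_summable_scale:
  fixes f :: "'v \<Rightarrow> complex"
  assumes "(\<lambda>v. (cmod (f v))\<^sup>2) summable_on UNIV"
  shows "(\<lambda>v. (cmod (c * f v))\<^sup>2) summable_on UNIV"
  using summable_on_cmult_right[OF assms, of "(cmod c)\<^sup>2"]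
  by (simp add: norm_mult power_mult_distrib)

lemma square_summable_product:
  fixes f g :: "'v \<Rightarrow> complex"
  assumes "(\<lambda>v. (cmod (f v))\<^sup>2) summable_on UNIV" "(\<lambda>v. (cmod (g v))\<^sup>2) summable_on UNIV"
  shows "(\<lambda>v. cnj (f v) * g v) summable_on UNIV"
proof (rule abs_summable_summable, rule Infinite_Sum.abs_summable_on_comparison_test')
  show "(\<lambda>v. (cmod (f v))\<^sup>2 + (cmod (g v))\<^sup>2) summable_on UNIV"
    by (intro summable_on_add assms)
  fix v
  have "0 \<le> cmod (f v) * cmod (g v)" by simp
  then show "cmod (cnj (f v) * g v) \<le> (cmod (f v))\<^sup>2 + (cmod (g v))\<^sup>2"
    using sum_squares_bound[of "cmod (f v)" "cmod (g v)"]
    unfolding norm_mult complex_mod_cnj by linarith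
qed

typedef 'v ell2 = "{f :: 'v \<Rightarrow> complex. (\<lambda>v. (cmod (f v))\<^sup>2) summable_on UNIV}"
  morphisms ell2_nth Abs_ell2
  by (rule exI[of _ "\<lambda>_. 0"]) simp

setup_lifting type_definition_ell2

lift_definition cinner :: "'v ell2 \<Rightarrow> 'v ell2 \<Rightarrow> complex"
  is "\<lambda>f g. \<Sum>\<^sub>\<infinity>v. cnj (f v) * g v" .

lift_definition cscale :: "complex \<Rightarrow> 'v ell2 \<Rightarrow> 'v ell2"
  is "\<lambda>c f v. c * f v" by (rule square_summable_scale)

lift_definition delta :: "'v \<Rightarrow> 'v ell2"
  is "\<lambda>u v. if v = u then 1 else 0"
  by (rule summable_on_cong_neutral[THEN iffD1, OF _ _ _ summable_on_finite[of "{u}" for u]]) auto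

lift_definition restrict_ell2 :: "'v set \<Rightarrow> 'v ell2 \<Rightarrow> 'v ell2"
  is "\<lambda>S f v. if v \<in> S then f v else 0"
  by (rule summable_on_comparison_test) auto

lemma cinner_self: "cinner f f = of_real (\<Sum>\<^sub>\<infinity>v. (cmod (ell2_nth f v))\<^sup>2)"
proof -
  have "((\<lambda>v. (cmod (ell2_nth f v))\<^sup>2) has_sum (\<Sum>\<^sub>\<infinity>v. (cmod (ell2_nth f v))\<^sup>2)) UNIV"
    using ell2_nth[of f] by (simp add: has_sum_infsum)
  then have "((\<lambda>v. complex_of_real ((cmod (ell2_nth f v))\<^sup>2)) has_sum
      of_real (\<Sum>\<^sub>\<infinity>v. (cmod (ell2_nth f v))\<^sup>2)) UNIV"
    by (simp only: has_sum_of_real_iff)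
  moreover have "cnj z * z = complex_of_real ((cmod z)\<^sup>2)" for z
    by (simp only: complex_norm_square mult.commute)
  ultimately show ?thesis
    unfolding cinner.rep_eq by (simp only: infsumI)
qed

instantiation ell2 :: (type) real_inner
begin

lift_definition zero_ell2 :: "'a ell2" is "\<lambda>_. 0" by simp
lift_definition plus_ell2 :: "'a ell2 \<Rightarrow> 'a ell2 \<Rightarrow> 'a ell2" is "\<lambda>f g v. f v + g v"
  by (rule square_summable_add)
lift_definition uminus_ell2 :: "'a ell2 \<Rightarrow> 'a ell2" is "\<lambda>f v. - f v" by simp
lift_definition minus_ell2 :: "'a ell2 \<Rightarrow> 'a ell2 \<Rightarrow> 'a ell2" is "\<lambda>f g v. f v - g v"
  using square_summable_add[of _ "\<lambda>v. - g v" for g] by fastforce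
lift_definition scaleR_ell2 :: "real \<Rightarrow> 'a ell2 \<Rightarrow> 'a ell2" is "\<lambda>r f v. of_real r * f v"
  by (rule square_summable_scale)

text \<open>The complex Hilbert space, regarded as a real one.\<close>

definition inner_ell2 :: "'a ell2 \<Rightarrow> 'a ell2 \<Rightarrow> real" where
  "inner_ell2 f g = Re (cinner f g)"
definition norm_ell2 :: "'a ell2 \<Rightarrow> real" where
  "norm_ell2 f = sqrt (inner f f)"
definition dist_ell2 :: "'a ell2 \<Rightarrow> 'a ell2 \<Rightarrow> real" where
  "dist_ell2 f g = norm (f - g)"
definition sgn_ell2 :: "'a ell2 \<Rightarrow> 'a ell2" where
  "sgn_ell2 f = inverse (norm f) *\<^sub>R f"
definition uniformity_ell2 :: "('a ell2 \<times> 'a ell2) filter" where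
  "uniformity_ell2 = (INF e\<in>{0<..}. principal {(x, y). dist x y < e})"
definition open_ell2 :: "'a ell2 set \<Rightarrow> bool" where
  "open_ell2 U = (\<forall>x\<in>U. eventually (\<lambda>(x', y). x' = x \<longrightarrow> y \<in> U) uniformity)"

instance
proof
  fix f g h :: "'a ell2" and r s :: real and U :: "'a ell2 set"
  show "f + g + h = f + (g + h)" "f + g = g + f" "0 + f = f" "- f + f = 0" "f - g = f + - g"
    "r *\<^sub>R (f + g) = r *\<^sub>R f + r *\<^sub>R g" "(r + s) *\<^sub>R f = r *\<^sub>R f + s *\<^sub>R f"
    "r *\<^sub>R s *\<^sub>R f = (r * s) *\<^sub>R f" "1 *\<^sub>R f = f"
    by (transfer; simp add: algebra_simps fun_eq_iff)+
  show "dist f g = norm (f - g)" "sgn f = inverse (norm f) *\<^sub>R f" "norm f = sqrt (inner f f)"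
    "uniformity = (INF e\<in>{0<..}. principal {(x :: 'a ell2, y). dist x y < e})"
    "open U = (\<forall>x\<in>U. \<forall>\<^sub>F (x', y) in uniformity. x' = x \<longrightarrow> y \<in> U)"
    by (simp_all add: dist_ell2_def sgn_ell2_def norm_ell2_def uniformity_ell2_def open_ell2_def)
  have "cinner g f = cnj (cinner f g)"
    by transfer (simp flip: infsum_cnj add: mult.commute)
  then show "inner f g = inner g f" by (simp add: inner_ell2_def)
  have "cinner (f + g) h = cinner f h + cinner g h"
    by transfer (simp add: ring_distribs infsum_add square_summable_product)
  then show "inner (f + g) h = inner f h + inner g h" by (simp add: inner_ell2_def)
  have "cinner (r *\<^sub>R f) g = r * cinner f g"
    by transfer (simp add: mult.assoc infsum_cmult_right')
  then show "inner (r *\<^sub>R f) g = r * inner f g" by (simp add: inner_ell2_def)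
  show "0 \<le> inner f f"
    by (simp add: inner_ell2_def cinner_self infsum_nonneg)
  show "inner f f = 0 \<longleftrightarrow> f = 0"
  proof
    assume "inner f f = 0"
    then have "(\<Sum>\<^sub>\<infinity>v. (cmod (ell2_nth f v))\<^sup>2) = 0" by (simp add: inner_ell2_def cinner_self)
    then have "(cmod (ell2_nth f v))\<^sup>2 = 0" for v
      using nonneg_infsum_le_0D[of "\<lambda>v. (cmod (ell2_nth f v))\<^sup>2" UNIV v] ell2_nth[of f] by simp
    then show "f = 0" by (simp add: ell2_nth_inject[symmetric] zero_ell2.rep_eq fun_eq_iff)
  qed (simp add: inner_ell2_def cinner.rep_eq zero_ell2.rep_eq)
qed

end

lemma norm_ell2_square: "(norm f)\<^sup>2 = (\<Sum>\<^sub>\<infinity>v. (cmod (ell2_nth f v))\<^sup>2)"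
  by (simp add: power2_norm_eq_inner inner_ell2_def cinner_self)

lemma finite_sum_le_norm_ell2: "finite S \<Longrightarrow> (\<Sum>v\<in>S. (cmod (ell2_nth f v))\<^sup>2) \<le> (norm f)\<^sup>2"
  unfolding norm_ell2_square using ell2_nth[of f] by (intro finite_sum_le_infsum) auto

lemma norm_ell2_leI:
  assumes "\<And>S. finite S \<Longrightarrow> (\<Sum>v\<in>S. (cmod (ell2_nth f v))\<^sup>2) \<le> c\<^sup>2" "0 \<le> c"
  shows "norm f \<le> c"
proof -
  have "(norm f)\<^sup>2 \<le> c\<^sup>2"
    unfolding norm_ell2_square using ell2_nth[of f] assms(1) by (intro infsum_le_finite_sums) auto
  then show ?thesis using assms(2) by (simp add: power2_le_iff_abs_le)
qed


section \<open>Operators and continuous functional calculus\<close>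

text \<open>
  Operators on the Hilbert space are elements of the library type of bounded \<^emph>\<open>real\<close>-linear maps,
  which carries the operator norm. Every operator the statement is about is complex linear,
  and a bounded real-linear inverse of a complex-linear map is complex linear, so the notions
  below agree with the usual ones for operators on a complex Hilbert space.
\<close>

type_synonym 'v operator = "'v ell2 \<Rightarrow>\<^sub>L 'v ell2"

definition cscale_op :: "complex \<Rightarrow> 'v operator" where
  "cscale_op c = Blinfun (cscale c)"

definition proj_op :: "'v set \<Rightarrow> 'v operator" where
  "proj_op S = Blinfun (restrict_ell2 S)"

lemma bounded_linear_cscale: "bounded_linear (cscale c :: 'v ell2 \<Rightarrow> 'v ell2)"
proof (rule bounded_linear_intro[where K = "cmod c"])
  fix f g :: "'v ell2" and r :: real
  show "cscale c (f + g) = cscale c f + cscale c g" "cscale c (r *\<^sub>R f) = r *\<^sub>R cscale c f"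
    by (transfer; simp add: algebra_simps fun_eq_iff)+
  show "norm (cscale c f) \<le> norm f * cmod c"
  proof (rule norm_ell2_leI)
    fix S :: "'v set" assume "finite S"
    then show "(\<Sum>v\<in>S. (cmod (ell2_nth (cscale c f) v))\<^sup>2) \<le> (norm f * cmod c)\<^sup>2"
      using mult_right_mono[OF finite_sum_le_norm_ell2[of S f], of "(cmod c)\<^sup>2"]
      by (simp add: cscale.rep_eq norm_mult power_mult_distrib sum_distrib_right)
        (simp add: mult.commute)
  qed simp
qed

lemma cscale_op_apply [simp]: "blinfun_apply (cscale_op c) f = cscale c f"
  by (simp add: cscale_op_def bounded_linear_Blinfun_apply bounded_linear_cscale)

lemma bounded_linear_restrict_ell2: "bounded_linear (restrict_ell2 (S :: 'v set))"
proof (rule bounded_linear_intro[where K = 1])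
  fix f g :: "'v ell2" and r :: real
  show "restrict_ell2 S (f + g) = restrict_ell2 S f + restrict_ell2 S g"
    "restrict_ell2 S (r *\<^sub>R f) = r *\<^sub>R restrict_ell2 S f"
    by (transfer; simp add: fun_eq_iff)+
  show "norm (restrict_ell2 S f) \<le> norm f * 1"
  proof (rule norm_ell2_leI)
    fix T :: "'v set" assume "finite T"
    have "(\<Sum>v\<in>T. (cmod (ell2_nth (restrict_ell2 S f) v))\<^sup>2) \<le> (\<Sum>v\<in>T. (cmod (ell2_nth f v))\<^sup>2)"
      by (intro sum_mono) (simp add: restrict_ell2.rep_eq)
    also have "\<dots> \<le> (norm f * 1)\<^sup>2" using \<open>finite T\<close> by (simp add: finite_sum_le_norm_ell2)
    finally show "(\<Sum>v\<in>T. (cmod (ell2_nth (restrict_ell2 S f) v))\<^sup>2) \<le> (norm f * 1)\<^sup>2" .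
  qed simp
qed

lemma proj_op_apply [simp]: "blinfun_apply (proj_op S) f = restrict_ell2 S f"
  by (simp add: proj_op_def bounded_linear_Blinfun_apply bounded_linear_restrict_ell2)

definition self_adjoint_op :: "'v operator \<Rightarrow> bool" where
  "self_adjoint_op T \<longleftrightarrow> (\<forall>f g. cinner (T f) g = cinner f (T g))"

definition positive_op :: "'v operator \<Rightarrow> bool" where
  "positive_op T \<longleftrightarrow> (\<forall>f. cinner f (T f) \<in> \<real> \<and> 0 \<le> Re (cinner f (T f)))"

definition op_trace :: "'v operator \<Rightarrow> complex" where
  "op_trace T = (\<Sum>\<^sub>\<infinity>v. cinner (delta v) (T (delta v)))"

definition op_power :: "'v operator \<Rightarrow> nat \<Rightarrow> 'v operator" where
  "op_power T k = (blinfun_compose T ^^ k) id_blinfun"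

definition op_poly :: "complex poly \<Rightarrow> 'v operator \<Rightarrow> 'v operator" where
  "op_poly p T = (\<Sum>k\<le>degree p. cscale_op (coeff p k) o\<^sub>L op_power T k)"

definition op_spectrum :: "'v operator \<Rightarrow> complex set" where
  "op_spectrum T = {z. \<not> (\<exists>S. S o\<^sub>L (T - cscale_op z) = id_blinfun \<and>
                              (T - cscale_op z) o\<^sub>L S = id_blinfun)}"

text \<open>
  Continuous functional calculus of a self-adjoint operator (whose spectrum is real):
  the operator-norm limit of \<open>p\<^sub>n(T)\<close> for polynomials \<open>p\<^sub>n\<close> converging to \<open>\<phi>\<close> uniformly
  on the spectrum. By the spectral theorem the limit does not depend on the approximation.
\<close>

definition op_fun :: "(real \<Rightarrow> complex) \<Rightarrow> 'v operator \<Rightarrow> 'v operator" where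
  "op_fun \<phi> T = (THE S. \<exists>p :: nat \<Rightarrow> complex poly.
     uniform_limit {x. complex_of_real x \<in> op_spectrum T}
       (\<lambda>n x. poly (p n) (complex_of_real x)) \<phi> sequentially \<and>
     (\<lambda>n. op_poly (p n) T) \<longlonglongrightarrow> S)"


section \<open>Graphs\<close>

record 'v graph =
  verts :: "'v set"
  edges :: "'v set set"

definition simple_graph :: "'v graph \<Rightarrow> bool" where
  "simple_graph G \<longleftrightarrow> (\<forall>e\<in>edges G. e \<subseteq> verts G \<and> card e = 2)"

definition nbrs :: "'v graph \<Rightarrow> 'v \<Rightarrow> 'v set" where
  "nbrs G v = {w. {v, w} \<in> edges G}"

definition bounded_degree :: "'v graph \<Rightarrow> bool" where
  "bounded_degree G \<longleftrightarrow> (\<exists>d. \<forall>v\<in>verts G. finite (nbrs G v) \<and> card (nbrs G v) \<le> d)"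

definition countable_bounded_graph :: "'v graph \<Rightarrow> bool" where
  "countable_bounded_graph G \<longleftrightarrow> simple_graph G \<and> countable (verts G) \<and> bounded_degree G"

definition subgraph :: "'v graph \<Rightarrow> 'v graph \<Rightarrow> bool" where
  "subgraph H G \<longleftrightarrow> simple_graph H \<and> verts H \<subseteq> verts G \<and> edges H \<subseteq> edges G"

text \<open>Path distance, infinite between different components.\<close>

definition gdist :: "'v graph \<Rightarrow> 'v \<Rightarrow> 'v \<Rightarrow> enat" where
  "gdist G u v = Inf (enat ` {k. (u, v) \<in> {(x, y). {x, y} \<in> edges G} ^^ k})"

definition gdist_set :: "'v graph \<Rightarrow> 'v \<Rightarrow> 'v set \<Rightarrow> enat" where
  "gdist_set G v S = (INF w\<in>S. gdist G v w)"

definition frontier_in :: "'v graph \<Rightarrow> 'v graph \<Rightarrow> 'v set" where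
  "frontier_in G K = {v \<in> verts K. gdist_set G v (verts G - verts K) = 1}"

definition adj_op :: "'v graph \<Rightarrow> 'v operator" where
  "adj_op G = Blinfun (\<lambda>f. Abs_ell2 (\<lambda>v. \<Sum>w\<in>nbrs G v. ell2_nth f w))"

lemma adj_op_apply:
  assumes "countable_bounded_graph G"
  shows "ell2_nth (blinfun_apply (adj_op G) f) v = (\<Sum>w\<in>nbrs G v. ell2_nth f w)"
proof -
  let ?A = "\<lambda>f v. \<Sum>w\<in>nbrs G v. ell2_nth f w"
  obtain d where d: "\<And>v. v \<in> verts G \<Longrightarrow> finite (nbrs G v) \<and> card (nbrs G v) \<le> d"
    using assms unfolding countable_bounded_graph_def bounded_degree_def by auto
  have fin: "finite (nbrs G v)" and card: "card (nbrs G v) \<le> d" for v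
  proof -
    have "nbrs G v = {}" if "v \<notin> verts G"
      using assms that unfolding countable_bounded_graph_def simple_graph_def nbrs_def by auto
    then show "finite (nbrs G v)" "card (nbrs G v) \<le> d" using d[of v] by fastforce+
  qed
  have sym: "w \<in> nbrs G v \<longleftrightarrow> v \<in> nbrs G w" for v w
    by (simp add: nbrs_def insert_commute)
  have bound: "(\<Sum>v\<in>S. (cmod (?A f v))\<^sup>2) \<le> (norm f * real d)\<^sup>2" if S: "finite S" for S f
  proof -
    let ?N = "\<Union>v\<in>S. nbrs G v"
    have N: "finite ?N" using S fin by auto
    have "(cmod (?A f v))\<^sup>2 \<le> real d * (\<Sum>w\<in>nbrs G v. (cmod (ell2_nth f w))\<^sup>2)" for v
    proof -
      have "(cmod (?A f v))\<^sup>2 \<le> (\<Sum>w\<in>nbrs G v. cmod (ell2_nth f w))\<^sup>2"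
        by (intro power_mono norm_sum) auto
      also have "\<dots> \<le> real (card (nbrs G v)) * (\<Sum>w\<in>nbrs G v. (cmod (ell2_nth f w))\<^sup>2)"
        using Cauchy_Schwarz_ineq_sum[of "\<lambda>_. 1" "\<lambda>w. cmod (ell2_nth f w)" "nbrs G v"] by simp
      also have "\<dots> \<le> real d * (\<Sum>w\<in>nbrs G v. (cmod (ell2_nth f w))\<^sup>2)"
        using card by (intro mult_right_mono sum_nonneg) auto
      finally show ?thesis .
    qed
    then have outer: "(\<Sum>v\<in>S. (cmod (?A f v))\<^sup>2)
        \<le> real d * (\<Sum>v\<in>S. \<Sum>w\<in>nbrs G v. (cmod (ell2_nth f w))\<^sup>2)"
      unfolding sum_distrib_left by (rule sum_mono)
    have "(\<Sum>v\<in>S. \<Sum>w\<in>nbrs G v. (cmod (ell2_nth f w))\<^sup>2)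
        = (\<Sum>w\<in>?N. \<Sum>v\<in>{v\<in>S. w \<in> nbrs G v}. (cmod (ell2_nth f w))\<^sup>2)"
    proof -
      have "nbrs G v = {w\<in>?N. w \<in> nbrs G v}" if "v \<in> S" for v using that by auto
      then have "(\<Sum>v\<in>S. \<Sum>w\<in>nbrs G v. (cmod (ell2_nth f w))\<^sup>2)
          = (\<Sum>v\<in>S. \<Sum>w\<in>{w\<in>?N. w \<in> nbrs G v}. (cmod (ell2_nth f w))\<^sup>2)"
        by (intro sum.cong) auto
      also have "\<dots> = (\<Sum>w\<in>?N. \<Sum>v\<in>{v\<in>S. w \<in> nbrs G v}. (cmod (ell2_nth f w))\<^sup>2)"
        using S N by (rule sum.swap_restrict)
      finally show ?thesis .
    qed
    also have "\<dots> \<le> (\<Sum>w\<in>?N. real d * (cmod (ell2_nth f w))\<^sup>2)"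
    proof (rule sum_mono)
      fix w
      have "card {v\<in>S. w \<in> nbrs G v} \<le> card (nbrs G w)"
        using fin sym by (intro card_mono) auto
      then have "card {v\<in>S. w \<in> nbrs G v} \<le> d" using card[of w] by linarith
      then show "(\<Sum>v\<in>{v\<in>S. w \<in> nbrs G v}. (cmod (ell2_nth f w))\<^sup>2)
          \<le> real d * (cmod (ell2_nth f w))\<^sup>2"
        by (simp add: mult_right_mono)
    qed
    also have "\<dots> \<le> real d * (norm f)\<^sup>2"
      using N by (simp add: sum_distrib_left[symmetric] finite_sum_le_norm_ell2 mult_left_mono)
    finally have inner: "(\<Sum>v\<in>S. \<Sum>w\<in>nbrs G v. (cmod (ell2_nth f w))\<^sup>2) \<le> real d * (norm f)\<^sup>2" .
    have "(\<Sum>v\<in>S. (cmod (?A f v))\<^sup>2) \<le> real d * (real d * (norm f)\<^sup>2)"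
      by (rule order_trans[OF outer mult_left_mono[OF inner]]) simp
    then show ?thesis by (simp add: power2_eq_square mult_ac)
  qed
  have in_ell2: "?A f \<in> {f. (\<lambda>v. (cmod (f v))\<^sup>2) summable_on UNIV}" for f
    using bound[of _ f]
    by (auto intro!: nonneg_bdd_above_summable_on bdd_aboveI[where M = "(norm f * real d)\<^sup>2"])
  have nth: "ell2_nth (Abs_ell2 (?A f)) = ?A f" for f
    using in_ell2 by (rule Abs_ell2_inverse)
  have "bounded_linear (\<lambda>f. Abs_ell2 (?A f))"
  proof (rule bounded_linear_intro[where K = "real d"])
    fix f g :: "'a ell2" and r :: real
    show "Abs_ell2 (?A (f + g)) = Abs_ell2 (?A f) + Abs_ell2 (?A g)"
      unfolding ell2_nth_inject[symmetric] nth by (simp add: plus_ell2.rep_eq sum.distrib nth)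
    show "Abs_ell2 (?A (r *\<^sub>R f)) = r *\<^sub>R Abs_ell2 (?A f)"
      unfolding ell2_nth_inject[symmetric] nth by (simp add: scaleR_ell2.rep_eq sum_distrib_left nth)
    show "norm (Abs_ell2 (?A f)) \<le> norm f * real d"
      by (rule norm_ell2_leI) (simp_all add: nth bound)
  qed
  then show ?thesis by (simp add: adj_op_def bounded_linear_Blinfun_apply nth)
qed


section \<open>Amenable periodic graphs\<close>

definition amenable_exhaustion :: "'v graph \<Rightarrow> (nat \<Rightarrow> 'v graph) \<Rightarrow> bool" where
  "amenable_exhaustion X K \<longleftrightarrow>
     (\<forall>n. subgraph (K n) X \<and> finite (verts (K n)) \<and> subgraph (K n) (K (Suc n))) \<and>
     (\<Union>n. verts (K n)) = verts X \<and> (\<Union>n. edges (K n)) = edges X \<and>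
     (\<lambda>n. real (card (frontier_in X (K n))) / real (card (verts (K n)))) \<longlonglongrightarrow> 0"

text \<open>Amenability of a discrete group: a left-invariant, finitely additive probability measure
  on all subsets.\<close>

definition amenable_group :: "('g, 'b) monoid_scheme \<Rightarrow> bool" where
  "amenable_group G \<longleftrightarrow> group G \<and>
     (\<exists>\<mu> :: 'g set \<Rightarrow> real.
        (\<forall>A\<subseteq>carrier G. 0 \<le> \<mu> A) \<and> \<mu> (carrier G) = 1 \<and>
        (\<forall>A B. A \<subseteq> carrier G \<and> B \<subseteq> carrier G \<and> A \<inter> B = {} \<longrightarrow> \<mu> (A \<union> B) = \<mu> A + \<mu> B) \<and>
        (\<forall>g\<in>carrier G. \<forall>A\<subseteq>carrier G. \<mu> (g <#\<^bsub>G\<^esub> A) = \<mu> A))"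

definition graph_automorphisms :: "'v graph \<Rightarrow> ('v \<Rightarrow> 'v) set" where
  "graph_automorphisms X = {g \<in> Bij (verts X).
     \<forall>u\<in>verts X. \<forall>v\<in>verts X. {g u, g v} \<in> edges X \<longleftrightarrow> {u, v} \<in> edges X}"

definition amenable_periodic_graph ::
    "'v graph \<Rightarrow> ('v \<Rightarrow> 'v) set \<Rightarrow> 'v set \<Rightarrow> (nat \<Rightarrow> 'v graph) \<Rightarrow> bool" where
  "amenable_periodic_graph X \<Gamma> F K \<longleftrightarrow>
     countable_bounded_graph X \<and> infinite (verts X) \<and>
     subgroup \<Gamma> (BijGroup (verts X)) \<and> \<Gamma> \<subseteq> graph_automorphisms X \<and> countable \<Gamma> \<and>
     amenable_group (BijGroup (verts X)\<lparr>carrier := \<Gamma>\<rparr>) \<and>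
     (\<forall>g\<in>\<Gamma>. \<forall>v\<in>verts X. g v = v \<longrightarrow> g = \<one>\<^bsub>BijGroup (verts X)\<^esub>) \<and>
     finite ((\<lambda>v. {g v |g. g \<in> \<Gamma>}) ` verts X) \<and>
     F \<subseteq> verts X \<and> (\<forall>v\<in>verts X. \<exists>!x. x \<in> F \<and> x \<in> {g v |g. g \<in> \<Gamma>}) \<and>
     amenable_exhaustion X K \<and>
     (\<exists>E :: nat \<Rightarrow> ('v \<Rightarrow> 'v) set. \<forall>n. finite (E n) \<and> E n \<subseteq> \<Gamma> \<and>
        verts (K n) - frontier_in X (K n) \<subseteq> (\<Union>g\<in>E n. g ` F) \<and>
        (\<Union>g\<in>E n. g ` F) \<subseteq> verts (K n))"


section \<open>The trace and density zero perturbations\<close>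

definition mean_trace :: "(nat \<Rightarrow> 'v graph) \<Rightarrow> 'v operator \<Rightarrow> nat \<Rightarrow> complex" where
  "mean_trace K T n = op_trace (T o\<^sub>L proj_op (verts (K n))) / of_nat (card (verts (K n)))"

text \<open>As \<^const>\<open>lim\<close> is unspecified for divergent sequences, equations between values of
  \<open>trace_Gamma\<close> are meaningful only together with \<open>has_trace\<close>.\<close>

definition has_trace :: "(nat \<Rightarrow> 'v graph) \<Rightarrow> 'v operator \<Rightarrow> bool" where
  "has_trace K T \<longleftrightarrow> convergent (mean_trace K T)"

definition trace_Gamma :: "(nat \<Rightarrow> 'v graph) \<Rightarrow> 'v operator \<Rightarrow> complex" where
  "trace_Gamma K T = lim (mean_trace K T)"

definition ess_zero_positive :: "(nat \<Rightarrow> 'v graph) \<Rightarrow> 'v operator \<Rightarrow> bool" where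
  "ess_zero_positive K T \<longleftrightarrow> positive_op T \<and> mean_trace K T \<longlonglongrightarrow> 0"

definition ess_zero :: "(nat \<Rightarrow> 'v graph) \<Rightarrow> 'v operator \<Rightarrow> bool" where
  "ess_zero K T \<longleftrightarrow> self_adjoint_op T \<and> ess_zero_positive K (T o\<^sub>L T)"

definition density_zero_perturbation ::
    "(nat \<Rightarrow> 'v graph) \<Rightarrow> 'v graph \<Rightarrow> 'v graph \<Rightarrow> bool" where
  "density_zero_perturbation K X Y \<longleftrightarrow> verts Y = verts X \<and> ess_zero K (adj_op X - adj_op Y)"

end

theory Submission
  imports Defs "HOL-Computational_Algebra.Fundamental_Theorem_Algebra"
begin

text \<open>
  Write \<open>D\<close> for \<open>A\<^sub>X - A\<^sub>Y\<close>. The diagonal entry of \<open>D\<^sup>2\<close> at \<open>v\<close> is the number of edges of the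
  symmetric difference at \<open>v\<close>, and summing over \<open>v\<close> counts each such edge once or twice.

  For the traces, polynomials that approximate \<open>\<phi>\<close> uniformly on an interval containing both spectra
  approximate \<open>\<phi>(A\<^sub>X)\<close> and \<open>\<phi>(A\<^sub>Y)\<close> in norm, because \<open>\<parallel>p(T)\<parallel>\<close> is at most the supremum of \<open>\<bar>p\<bar>\<close> on the
  spectrum of a self-adjoint operator \<open>T\<close>. As the mean traces are contractions for the operator norm,
  it is enough to treat powers. The diagonal of \<open>A\<^sub>X\<^sup>k\<close> is \<open>\<Gamma>\<close>-invariant, so that its averages over the
  exhaustion converge, and it counts closed walks, so that it differs from the diagonal of \<open>A\<^sub>Y\<^sup>k\<close> only
  within distance \<open>k\<close> of an end of an edge of the symmetric difference. Such vertices have density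
  zero, since all but the few near the frontier of \<open>K\<^sub>n\<close> are near an end in \<open>K\<^sub>n\<close>.
\<close>

section \<open>Completeness of the Hilbert space\<close>

lemma cinner_commute: "cinner g f = cnj (cinner f g)"
  by transfer (simp flip: infsum_cnj add: mult.commute)

lemma cinner_cscale_left: "cinner (cscale c f) g = cnj c * cinner f g"
  by transfer (simp add: mult.assoc infsum_cmult_right')

lemma cinner_cscale_right: "cinner f (cscale c g) = c * cinner f g"
  by (subst cinner_commute, subst cinner_cscale_left, subst cinner_commute) simp

lemma cinner_add_left: "cinner (f + g) h = cinner f h + cinner g h"
  by transfer (simp add: ring_distribs infsum_add square_summable_product)

lemma cinner_minus_left: "cinner (- f) h = - cinner f h"
  by transfer (simp add: infsum_uminus)

lemma cinner_diff_left: "cinner (f - g) h = cinner f h - cinner g h"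
  using cinner_add_left[of f "- g" h] by (simp add: cinner_minus_left)

lemma cinner_diff_right: "cinner f (g - h) = cinner f g - cinner f h"
  by (subst cinner_commute, subst cinner_diff_left, simp, subst (1 2) cinner_commute) simp

lemma inner_cscale: "inner (cscale c f) g = inner f (cscale (cnj c) g)"
  by (simp add: inner_ell2_def cinner_cscale_left cinner_cscale_right)

lemma cscale_cscale: "cscale a (cscale b f) = cscale (a * b) f"
  by transfer (simp add: mult.assoc)

lemma cscale_of_real: "cscale (of_real r) f = r *\<^sub>R f"
  by transfer simp

lemma cscale_diff_right: "cscale c (f - g) = cscale c f - cscale c g"
  by (transfer; simp add: algebra_simps fun_eq_iff)

lemma cscale_add_left: "cscale (a + b) f = cscale a f + cscale b f"
  by (transfer; simp add: algebra_simps fun_eq_iff)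

lemma has_sum_single: "f u = c \<Longrightarrow> (\<And>v. v \<noteq> u \<Longrightarrow> f v = 0) \<Longrightarrow> (f has_sum c) UNIV"
  by (rule has_sum_finite_neutralI[of "{u}"]) auto

lemma cinner_delta_left [simp]: "cinner (delta u) f = ell2_nth f u"
  unfolding cinner.rep_eq delta.rep_eq by (rule infsumI, rule has_sum_single) auto

lemma norm_delta [simp]: "norm (delta u) = 1"
  by (simp add: norm_eq_sqrt_inner inner_ell2_def delta.rep_eq)

lemma cmod_ell2_nth_le: "cmod (ell2_nth f v) \<le> norm f"
  using finite_sum_le_norm_ell2[of "{v}" f] by (simp add: power2_le_iff_abs_le)

lemma ell2_eqI: "(\<And>v. ell2_nth f v = ell2_nth g v) \<Longrightarrow> f = g"
  by (simp flip: ell2_nth_inject add: fun_eq_iff)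

text \<open>The contraction argument and the norm limits of operators below need completeness. A
  Cauchy sequence converges entrywise to some \<open>g\<close>. Bounds on finite partial sums,
  uniform in the finite set, make \<open>g\<close> square summable and turn entrywise convergence
  into convergence in norm.\<close>

instance ell2 :: (type) banach
proof
  fix f :: "nat \<Rightarrow> 'a ell2"
  assume "Cauchy f"
  have "Cauchy (\<lambda>n. ell2_nth (f n) v)" for v
  proof (rule metric_CauchyI)
    fix e :: real assume "0 < e"
    then obtain M where "\<And>m n. m \<ge> M \<Longrightarrow> n \<ge> M \<Longrightarrow> norm (f m - f n) < e"
      using \<open>Cauchy f\<close> unfolding Cauchy_def dist_norm by blast
    then have "dist (ell2_nth (f m) v) (ell2_nth (f n) v) < e" if "m \<ge> M" "n \<ge> M" for m n
      using cmod_ell2_nth_le[of "f m - f n" v] that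
      by (simp add: dist_norm minus_ell2.rep_eq le_less_trans)
    then show "\<exists>M. \<forall>m\<ge>M. \<forall>n\<ge>M. dist (ell2_nth (f m) v) (ell2_nth (f n) v) < e" by blast
  qed
  then obtain g where g: "\<And>v. (\<lambda>n. ell2_nth (f n) v) \<longlonglongrightarrow> g v"
    unfolding Cauchy_convergent_iff convergent_def by metis
  \<comment> \<open>\<open>M\<close> comes from the Cauchy condition alone and so does not depend on
    \<open>S\<close>; for finite \<open>S\<close> the bound survives letting \<open>m\<close> tend
    to infinity.\<close>
  have key: "\<exists>M. \<forall>n\<ge>M. \<forall>S. finite S \<longrightarrow> (\<Sum>v\<in>S. (cmod (ell2_nth (f n) v - g v))\<^sup>2) \<le> e\<^sup>2"
    if "0 < e" for e
  proof -
    obtain M where M: "\<And>m n. m \<ge> M \<Longrightarrow> n \<ge> M \<Longrightarrow> norm (f m - f n) < e"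
      using \<open>Cauchy f\<close> \<open>0 < e\<close> unfolding Cauchy_def dist_norm by blast
    have "(\<Sum>v\<in>S. (cmod (ell2_nth (f n) v - g v))\<^sup>2) \<le> e\<^sup>2" if "n \<ge> M" "finite S" for n S
    proof (rule tendsto_upperbound)
      show "(\<lambda>m. \<Sum>v\<in>S. (cmod (ell2_nth (f n) v - ell2_nth (f m) v))\<^sup>2)
          \<longlonglongrightarrow> (\<Sum>v\<in>S. (cmod (ell2_nth (f n) v - g v))\<^sup>2)"
        by (intro tendsto_intros g)
      show "\<forall>\<^sub>F m in sequentially. (\<Sum>v\<in>S. (cmod (ell2_nth (f n) v - ell2_nth (f m) v))\<^sup>2) \<le> e\<^sup>2"
        using eventually_ge_at_top[of M]
      proof eventually_elim
        case (elim m)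
        have "(\<Sum>v\<in>S. (cmod (ell2_nth (f n - f m) v))\<^sup>2) \<le> (norm (f n - f m))\<^sup>2"
          using \<open>finite S\<close> by (rule finite_sum_le_norm_ell2)
        also have "\<dots> \<le> e\<^sup>2" using M[OF \<open>n \<ge> M\<close> elim] by (intro power_mono) auto
        finally show ?case by (simp add: minus_ell2.rep_eq)
      qed
    qed simp
    then show ?thesis by blast
  qed
  obtain N where N: "\<And>S. finite S \<Longrightarrow> (\<Sum>v\<in>S. (cmod (ell2_nth (f N) v - g v))\<^sup>2) \<le> 1\<^sup>2"
    using key[of 1] by auto
  have "(\<lambda>v. (cmod (ell2_nth (f N) v - g v))\<^sup>2) summable_on UNIV"
    by (rule nonneg_bdd_above_summable_on) (auto intro!: bdd_aboveI[where M = "1\<^sup>2"] N)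
  \<comment> \<open>The sum inside equals \<open>g v\<close>: an element of the space minus a square
    summable difference.\<close>
  then have "(\<lambda>v. (cmod (ell2_nth (f N) v + (- 1) * (ell2_nth (f N) v - g v)))\<^sup>2) summable_on UNIV"
    using ell2_nth[of "f N"] by (intro square_summable_add square_summable_scale) auto
  then have nth: "ell2_nth (Abs_ell2 g) = g"
    by (intro Abs_ell2_inverse) simp
  have "f \<longlonglongrightarrow> Abs_ell2 g"
  proof (rule metric_LIMSEQ_I)
    fix e :: real assume "0 < e"
    then obtain M where
      "\<forall>n\<ge>M. \<forall>S. finite S \<longrightarrow> (\<Sum>v\<in>S. (cmod (ell2_nth (f n) v - g v))\<^sup>2) \<le> (e/2)\<^sup>2"
      using key[of "e/2"] by auto
    then have "norm (f n - Abs_ell2 g) \<le> e / 2" if "n \<ge> M" for n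
      using that \<open>0 < e\<close> by (intro norm_ell2_leI) (auto simp: minus_ell2.rep_eq nth)
    then show "\<exists>M. \<forall>n\<ge>M. dist (f n) (Abs_ell2 g) < e"
      using \<open>0 < e\<close> by (intro exI[of _ M]) (force simp: dist_norm intro: le_less_trans[of _ "e / 2"])
  qed
  then show "convergent f" by (auto simp: convergent_def)
qed


section \<open>Invertibility of coercive operators\<close>

definition invertible_op :: "('a::real_normed_vector \<Rightarrow>\<^sub>L 'a) \<Rightarrow> bool" where
  "invertible_op B \<longleftrightarrow> (\<exists>S. S o\<^sub>L B = id_blinfun \<and> B o\<^sub>L S = id_blinfun)"

lemma invertible_opI: "S o\<^sub>L B = id_blinfun \<Longrightarrow> B o\<^sub>L S = id_blinfun \<Longrightarrow> invertible_op B"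
  unfolding invertible_op_def by blast

lemma invertible_op_compose:
  assumes "invertible_op A" "invertible_op B"
  shows "invertible_op (A o\<^sub>L B)"
proof -
  obtain A' B' where "A' o\<^sub>L A = id_blinfun" "A o\<^sub>L A' = id_blinfun"
    "B' o\<^sub>L B = id_blinfun" "B o\<^sub>L B' = id_blinfun"
    using assms unfolding invertible_op_def by blast
  then have "A' (A x) = x" "A (A' x) = x" "B' (B x) = x" "B (B' x) = x" for x
    by (simp_all flip: blinfun_apply_blinfun_compose)
  then show ?thesis
    by (intro invertible_opI[of "B' o\<^sub>L A'"]) (auto intro!: blinfun_eqI)
qed

text \<open>The solution of \<open>B x = y\<close> is the fixed point of the contraction
  \<open>x \<mapsto> x - t (B x - y)\<close> for small \<open>t > 0\<close> (Lax--Milgram).\<close>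

lemma coercive_invertible:
  fixes B :: "'a::{real_inner,banach} \<Rightarrow>\<^sub>L 'a"
  assumes "0 < c" and coercive: "\<And>x. c * (norm x)\<^sup>2 \<le> inner (B x) x"
  shows "invertible_op B"
proof -
  \<comment> \<open>This lower bound gives injectivity, and later the norm bound
    \<open>1 / c\<close> for the inverse.\<close>
  have below: "c * norm x \<le> norm (B x)" for x
  proof (cases "x = 0")
    case False
    have "c * norm x * norm x \<le> norm (B x) * norm x"
      using coercive[of x] norm_cauchy_schwarz[of "B x" x] by (simp add: power2_eq_square)
    then show ?thesis using False by simp
  qed simp
  have inj: "inj (blinfun_apply B)"
  proof (rule injI)
    fix x y assume "B x = B y"
    then show "x = y" using below[of "x - y"] \<open>0 < c\<close> by (simp add: blinfun.diff_right mult_le_0_iff)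
  qed
  have "\<exists>x. B x = y" for y
  proof -
    \<comment> \<open>With \<open>t * (norm B)\<^sup>2\<close> at most \<open>c\<close>, expanding
      the square contracts the squared norm by \<open>1 - 2 * t * c + t * c = 1 - t * c\<close>. The
      summand 1 keeps the denominator positive even for \<open>B = 0\<close>.\<close>
    define t where "t = c / ((norm B)\<^sup>2 + 1)"
    have pos: "0 < (norm B)\<^sup>2 + 1" by (simp add: add_nonneg_pos)
    then have "0 < t" using \<open>0 < c\<close> by (simp add: t_def)
    have tB: "t * (norm B)\<^sup>2 \<le> c"
      using pos \<open>0 < c\<close> by (simp add: t_def field_simps)
    \<comment> \<open>The maximum covers the trivial space, where \<open>c\<close> may be so large
      that \<open>1 - t * c\<close> is negative.\<close>
    define k where "k = sqrt (max 0 (1 - t * c))"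
    have contr: "norm (x - t *\<^sub>R B x) \<le> k * norm x" for x
    proof (rule power2_le_imp_le)
      have "(norm (x - t *\<^sub>R B x))\<^sup>2 = (norm x)\<^sup>2 - 2 * t * inner (B x) x + t\<^sup>2 * (norm (B x))\<^sup>2"
        unfolding power2_norm_eq_inner
        by (simp add: inner_diff_left inner_diff_right inner_commute[of x "B x"] algebra_simps
            power2_eq_square)
      also have "(norm (B x))\<^sup>2 \<le> (norm B)\<^sup>2 * (norm x)\<^sup>2"
        using power_mono[OF norm_blinfun[of B x], of 2] by (simp add: power_mult_distrib)
      then have "t\<^sup>2 * (norm (B x))\<^sup>2 \<le> t * ((t * (norm B)\<^sup>2) * (norm x)\<^sup>2)"
        using \<open>0 < t\<close> by (simp add: power2_eq_square mult.assoc)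
      also have "\<dots> \<le> t * (c * (norm x)\<^sup>2)"
        using tB \<open>0 < t\<close> by (intro mult_left_mono mult_right_mono) auto
      also have "(norm x)\<^sup>2 - 2 * t * inner (B x) x \<le> (norm x)\<^sup>2 - 2 * t * (c * (norm x)\<^sup>2)"
        using coercive[of x] \<open>0 < t\<close> by simp
      finally have "(norm (x - t *\<^sub>R B x))\<^sup>2 \<le> (1 - t * c) * (norm x)\<^sup>2"
        by (simp add: algebra_simps)
      also have "\<dots> \<le> max 0 (1 - t * c) * (norm x)\<^sup>2" by (intro mult_right_mono) auto
      finally show "(norm (x - t *\<^sub>R B x))\<^sup>2 \<le> (k * norm x)\<^sup>2"
        by (simp add: k_def power_mult_distrib)
    qed (simp add: k_def)
    have "k < 1" using \<open>0 < c\<close> \<open>0 < t\<close> by (simp add: k_def)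
    moreover have "0 \<le> k" by (simp add: k_def)
    moreover have "dist (x - t *\<^sub>R (B x - y)) (z - t *\<^sub>R (B z - y)) \<le> k * dist x z" for x z
      using contr[of "x - z"] by (simp add: dist_norm blinfun.diff_right algebra_simps)
    ultimately obtain x where "x - t *\<^sub>R (B x - y) = x"
      using banach_fix_type[of k "\<lambda>x. x - t *\<^sub>R (B x - y)"] by blast
    then show ?thesis using \<open>0 < t\<close> by auto
  qed
  then obtain s where s: "\<And>y. B (s y) = y" by metis
  have "bounded_linear s"
  proof (rule bounded_linear_intro[where K = "1 / c"])
    show "s (x + y) = s x + s y" "s (r *\<^sub>R x) = r *\<^sub>R s x" for x y r
      by (rule injD[OF inj], simp add: s blinfun.add_right blinfun.scaleR_right)+
    show "norm (s x) \<le> norm x * (1 / c)" for x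
      using below[of "s x"] \<open>0 < c\<close> by (simp add: s field_simps)
  qed
  then have "Blinfun s x = s x" for x by (simp add: bounded_linear_Blinfun_apply)
  moreover have "s (B x) = x" for x by (rule injD[OF inj]) (simp add: s)
  ultimately show ?thesis
    by (intro invertible_opI[of "Blinfun s"]) (auto intro!: blinfun_eqI simp: s)
qed


section \<open>Polynomials of a self-adjoint operator\<close>

lemma self_adjoint_op_inner: "self_adjoint_op T \<Longrightarrow> inner (T f) g = inner f (T g)"
  by (simp add: self_adjoint_op_def inner_ell2_def)

text \<open>Operators are only real linear by type; here complex linearity is recovered, because
  both sides have the same inner product with every \<open>g\<close>.\<close>

lemma self_adjoint_op_cscale:
  assumes "self_adjoint_op T"
  shows "T (cscale c f) = cscale c (T f)"
proof -
  have "inner (T (cscale c f)) g = inner (cscale c (T f)) g" for g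
    using assms by (simp add: self_adjoint_op_def inner_ell2_def cinner_cscale_left)
  then show ?thesis by (metis vector_eq_rdot)
qed

lemma cscale_minus_left: "cscale (- c) f = - cscale c f"
  by transfer simp

lemma op_power_0 [simp]: "op_power T 0 = id_blinfun"
  by (simp add: op_power_def)

lemma op_power_Suc [simp]: "op_power T (Suc k) = T o\<^sub>L op_power T k"
  by (simp add: op_power_def)

lemma op_power_commute: "op_power T k (T f) = T (op_power T k f)"
  by (induction k arbitrary: f) auto

text \<open>The free upper bound \<open>n\<close> lets polynomials of different degrees be expanded
  over a common range; the surplus coefficients are 0.\<close>

lemma op_poly_apply:
  assumes "degree p \<le> n"
  shows "op_poly p T f = (\<Sum>k\<le>n. cscale (coeff p k) (op_power T k f))"
proof -
  have "op_poly p T f = (\<Sum>k\<le>degree p. cscale (coeff p k) (op_power T k f))"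
    by (simp add: op_poly_def blinfun.sum_left)
  also have "\<dots> = (\<Sum>k\<le>n. cscale (coeff p k) (op_power T k f))"
  proof (rule sum.mono_neutral_left)
    have "cscale 0 g = 0" for g :: "'a ell2"
      using cscale_of_real[of 0 g] by simp
    then show "\<forall>i\<in>{..n} - {..degree p}. cscale (coeff p i) (op_power T i f) = 0"
      by (simp add: coeff_eq_0)
  qed (use assms in auto)
  finally show ?thesis .
qed

lemma op_poly_0 [simp]: "op_poly 0 T = 0"
  by (rule blinfun_eqI) (use cscale_of_real[of 0] in \<open>simp add: op_poly_def\<close>)

lemma op_poly_add: "op_poly (p + q) T = op_poly p T + op_poly q T"
proof (rule blinfun_eqI)
  fix f
  let ?n = "max (degree p) (degree q)"
  show "op_poly (p + q) T f = (op_poly p T + op_poly q T) f"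
    by (simp add: op_poly_apply[where n = ?n] degree_add_le blinfun.add_left cscale_add_left
        sum.distrib)
qed

lemma cscale_sum_right: "cscale c (sum g A) = (\<Sum>a\<in>A. cscale c (g a))"
  using blinfun.sum_right[of "cscale_op c" g A] by simp

lemma op_poly_smult_apply: "op_poly (smult c p) T f = cscale c (op_poly p T f)"
  by (simp add: op_poly_apply[where n = "degree p"] degree_smult_le cscale_cscale
      cscale_sum_right)

lemma op_poly_diff: "op_poly (p - q) T = op_poly p T - op_poly q T"
  using op_poly_add[of "p - q" q T] by simp

context
  fixes T :: "'v operator"
  assumes sa: "self_adjoint_op T"
begin

lemma op_poly_pCons: "op_poly (pCons a p) T f = cscale a f + T (op_poly p T f)"
proof -
  have "degree (pCons a p) \<le> Suc (degree p)" by (rule degree_pCons_le)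
  then show ?thesis
    by (simp add: op_poly_apply[where n = "degree p"] op_poly_apply[where n = "Suc (degree p)"]
        sum.atMost_Suc_shift blinfun.sum_right self_adjoint_op_cscale[OF sa]
        del: sum.atMost_Suc)
qed

text \<open>Self-adjointness enters through complex linearity: the coefficients have to move past
  \<open>T\<close>.\<close>

lemma op_poly_mult: "op_poly (p * q) T = op_poly p T o\<^sub>L op_poly q T"
proof (induction p)
  case (pCons a p)
  show ?case
  proof (rule blinfun_eqI)
    fix f
    have "op_poly (pCons a p * q) T f = op_poly (smult a q) T f + op_poly (pCons 0 (p * q)) T f"
      by (simp only: mult_pCons_left op_poly_add blinfun.add_left)
    then show "op_poly (pCons a p * q) T f = (op_poly (pCons a p) T o\<^sub>L op_poly q T) f"
      using cscale_of_real[of 0 f] pCons.IH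
      by (simp add: op_poly_smult_apply op_poly_pCons)
  qed
qed (simp add: blinfun_eqI)

lemma op_poly_linear: "op_poly [:- z, 1:] T = T - cscale_op z"
proof (rule blinfun_eqI)
  fix f
  show "op_poly [:- z, 1:] T f = (T - cscale_op z) f"
    using cscale_add_left[of z "- z" f] cscale_of_real[of 0 f] cscale_of_real[of 1 f]
    by (simp add: op_poly_pCons blinfun.diff_left add_eq_0_iff)
qed

lemma op_poly_commute: "op_poly p T (T f) = T (op_poly p T f)"
  by (induction p arbitrary: f)
    (simp_all add: op_poly_pCons self_adjoint_op_cscale[OF sa] blinfun.add_right)

text \<open>A scalar crosses even the real inner product as its conjugate, while \<open>T\<close>
  crosses unchanged, so only the coefficients are conjugated.\<close>

lemma op_poly_adjoint: "inner (op_poly p T f) g = inner f (op_poly (map_poly cnj p) T g)"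
  by (induction p arbitrary: f g)
    (simp_all add: op_poly_pCons map_poly_pCons inner_add_left inner_add_right inner_cscale
      self_adjoint_op_inner[OF sa] op_poly_commute)

end


section \<open>Continuous functional calculus\<close>

lemma cscale_op_inverse:
  "c \<noteq> 0 \<Longrightarrow> cscale_op (inverse c) o\<^sub>L cscale_op c = id_blinfun"
  "c \<noteq> 0 \<Longrightarrow> cscale_op c o\<^sub>L cscale_op (inverse c) = id_blinfun"
  using cscale_of_real[of 1] by (auto intro!: blinfun_eqI simp: cscale_cscale)

lemma invertible_cscale_op: "c \<noteq> 0 \<Longrightarrow> invertible_op (cscale_op c)"
  using cscale_op_inverse by (rule invertible_opI)

text \<open>Coercivity sees only the real part of the complex form, so an operator is multiplied by
  a suitable scalar before \<open>coercive_invertible\<close> is applied. This removes the scalar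
  again.\<close>

lemma invertible_op_cscale_cancel:
  assumes "c \<noteq> 0" "invertible_op (cscale_op c o\<^sub>L A)"
  shows "invertible_op A"
proof -
  have "cscale_op (inverse c) o\<^sub>L (cscale_op c o\<^sub>L A) = A"
    using assms(1) cscale_of_real[of 1] by (auto intro!: blinfun_eqI simp: cscale_cscale)
  then show ?thesis
    using invertible_op_compose[OF invertible_cscale_op[of "inverse c"] assms(2)] assms(1) by simp
qed

lemma op_spectrum_iff: "z \<in> op_spectrum T \<longleftrightarrow> \<not> invertible_op (T - cscale_op z)"
  by (simp add: op_spectrum_def invertible_op_def)

lemma inner_cscale_self: "inner (cscale c f) f = Re c * (norm f)\<^sup>2"
proof -
  have "cinner f f = of_real ((norm f)\<^sup>2)" by (simp add: cinner_self norm_ell2_square)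
  then show ?thesis by (simp add: inner_ell2_def cinner_cscale_left)
qed

text \<open>On an approximate maximiser of \<open>\<parallel>Q x\<parallel>\<close> the vector \<open>Q\<^sup>2 x - \<parallel>Q\<parallel>\<^sup>2 x\<close> is small.\<close>

lemma self_adjoint_norm_not_invertible:
  fixes Q :: "'a::real_inner \<Rightarrow>\<^sub>L 'a"
  assumes sa: "\<And>x y. inner (Q x) y = inner x (Q y)" and "v \<noteq> (0 :: 'a)"
  shows "\<not> invertible_op ((Q o\<^sub>L Q) - (norm Q)\<^sup>2 *\<^sub>R id_blinfun)"
proof
  let ?l = "norm Q"
  assume "invertible_op ((Q o\<^sub>L Q) - ?l\<^sup>2 *\<^sub>R id_blinfun)"
  then obtain S where S: "S o\<^sub>L ((Q o\<^sub>L Q) - ?l\<^sup>2 *\<^sub>R id_blinfun) = id_blinfun"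
    unfolding invertible_op_def by blast
  have S: "S (Q (Q x) - ?l\<^sup>2 *\<^sub>R x) = x" for x
    using arg_cong[OF S, of "\<lambda>A. blinfun_apply A x"]
    by (simp add: blinfun.diff_left blinfun.scaleR_left)
  show False
  proof (cases "Q = 0")
    case True
    then show False using S[of v] \<open>v \<noteq> 0\<close> by simp
  next
    case False
    then have l: "0 < ?l" by simp
    define C where "C = (norm S)\<^sup>2"
    have "S \<noteq> 0" using S[of v] \<open>v \<noteq> 0\<close> by auto
    then have C: "0 < C" by (simp add: C_def)
    \<comment> \<open>An inverse bounds \<open>norm x\<close> by \<open>norm S\<close> times the
      norm of \<open>Q (Q x) - ?l\<^sup>2 *\<^sub>R x\<close>. Expanding the square and estimating
      \<open>norm (Q (Q x))\<close> by \<open>?l * norm (Q x)\<close> keeps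
      \<open>norm (Q x)\<close> uniformly below \<open>?l * norm x\<close>.\<close>
    have bound: "C * ?l\<^sup>2 * (norm (Q x))\<^sup>2 \<le> (C * ?l ^ 4 - 1) * (norm x)\<^sup>2" for x
    proof -
      have "(norm x)\<^sup>2 \<le> (norm S * norm (Q (Q x) - ?l\<^sup>2 *\<^sub>R x))\<^sup>2"
        using norm_blinfun[of S "Q (Q x) - ?l\<^sup>2 *\<^sub>R x"] by (intro power_mono) (simp_all add: S)
      also have "\<dots> = C * (norm (Q (Q x) - ?l\<^sup>2 *\<^sub>R x))\<^sup>2"
        by (simp add: C_def power_mult_distrib)
      also have "(norm (Q (Q x) - ?l\<^sup>2 *\<^sub>R x))\<^sup>2
          = (norm (Q (Q x)))\<^sup>2 - 2 * ?l\<^sup>2 * (norm (Q x))\<^sup>2 + ?l ^ 4 * (norm x)\<^sup>2"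
        unfolding power2_norm_eq_inner[of "Q (Q x) - ?l\<^sup>2 *\<^sub>R x"] power2_norm_eq_inner[of "Q (Q x)"]
          power2_norm_eq_inner[of "Q x"] power2_norm_eq_inner[of "x"]
        by (simp add: inner_diff_left inner_diff_right sa[of "Q x" x] sa[of x "Q x", symmetric]
            algebra_simps power2_eq_square power4_eq_xxxx)
      also have "(norm (Q (Q x)))\<^sup>2 \<le> ?l\<^sup>2 * (norm (Q x))\<^sup>2"
        using power_mono[OF norm_blinfun[of Q "Q x"], of 2] by (simp add: power_mult_distrib)
      finally have "(norm x)\<^sup>2 \<le> C * (?l ^ 4 * (norm x)\<^sup>2 - ?l\<^sup>2 * (norm (Q x))\<^sup>2)"
        using C by (simp add: algebra_simps)
      then show ?thesis by (simp add: algebra_simps)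
    qed
    \<comment> \<open>\<open>K\<close> equals \<open>?l\<^sup>2 - 1 / (C * ?l\<^sup>2)\<close>, so
      \<open>sqrt K\<close> would be a bound for \<open>Q\<close> smaller than its norm.\<close>
    define K where "K = (C * ?l ^ 4 - 1) / (C * ?l\<^sup>2)"
    have K: "(norm (Q x))\<^sup>2 \<le> K * (norm x)\<^sup>2" for x
      using bound[of x] C l by (simp add: K_def field_simps)
    have "0 \<le> K * (norm v)\<^sup>2" using K[of v] by (rule order_trans[rotated]) simp
    then have "0 \<le> K" using \<open>v \<noteq> 0\<close> by (simp add: zero_le_mult_iff)
    have "?l \<le> sqrt K"
    proof (rule norm_blinfun_bound)
      fix x
      have "(norm (Q x))\<^sup>2 \<le> (sqrt K * norm x)\<^sup>2"
        using K[of x] \<open>0 \<le> K\<close> by (simp add: power_mult_distrib)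
      then show "norm (Q x) \<le> sqrt K * norm x"
        by (rule power2_le_imp_le) (simp add: \<open>0 \<le> K\<close>)
    qed (simp add: \<open>0 \<le> K\<close>)
    then have "?l\<^sup>2 \<le> K" using l \<open>0 \<le> K\<close> by (metis less_imp_le power_mono real_sqrt_pow2)
    moreover have "K = ?l\<^sup>2 - 1 / (C * ?l\<^sup>2)"
      using C l by (simp add: K_def field_simps power2_eq_square power4_eq_xxxx)
    moreover have "0 < 1 / (C * ?l\<^sup>2)" using C l by (intro divide_pos_pos mult_pos_pos) auto
    ultimately show False by linarith
  qed
qed

section \<open>Spectrum of a self-adjoint operator and the norm of its polynomials\<close>

context
  fixes T :: "'v operator"
  assumes sa: "self_adjoint_op T"
begin

text \<open>For \<open>z = x + i y\<close> multiply \<open>T - z\<close> by \<open>i y\<close>. The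
  form of \<open>i y T\<close> has real part 0 and \<open>- i y z\<close> contributes
  \<open>y\<^sup>2\<close>, so the product is coercive unless \<open>y = 0\<close>.\<close>

lemma self_adjoint_spectrum_real:
  assumes "z \<in> op_spectrum T"
  shows "Im z = 0"
proof (rule ccontr)
  assume "Im z \<noteq> 0"
  let ?c = "\<i> * of_real (Im z)"
  have "invertible_op (cscale_op ?c o\<^sub>L (T - cscale_op z))"
  proof (rule coercive_invertible)
    fix f
    have "inner (cscale ?c (T f)) f = - inner (cscale ?c (T f)) f"
    proof -
      have "inner (cscale ?c (T f)) f = inner f (T (cscale (- ?c) f))"
        by (simp add: inner_cscale self_adjoint_op_inner[OF sa])
      also have "\<dots> = - inner f (cscale ?c (T f))"
        unfolding self_adjoint_op_cscale[OF sa]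
        by (simp add: cscale_minus_left)
      finally show ?thesis by (simp add: inner_commute)
    qed
    then have "inner (cscale ?c (T f)) f = 0" by simp
    moreover have "inner (cscale ?c (cscale z f)) f = - ((Im z)\<^sup>2 * (norm f)\<^sup>2)"
      by (simp add: cscale_cscale inner_cscale_self power2_eq_square)
    ultimately show "(Im z)\<^sup>2 * (norm f)\<^sup>2 \<le> inner ((cscale_op ?c o\<^sub>L (T - cscale_op z)) f) f"
      by (simp add: blinfun.diff_left cscale_diff_right inner_diff_left)
  qed (use \<open>Im z \<noteq> 0\<close> in simp)
  then have "invertible_op (T - cscale_op z)"
    by (rule invertible_op_cscale_cancel[rotated]) (use \<open>Im z \<noteq> 0\<close> in simp)
  then show False using assms by (simp add: op_spectrum_iff)
qed

text \<open>Multiplying \<open>T - x\<close> by \<open>- x\<close> gives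
  \<open>x\<^sup>2 - x T\<close>, whose form is at least
  \<open>\<bar>x\<bar> * (\<bar>x\<bar> - norm T)\<close> times the squared norm.\<close>

lemma self_adjoint_spectrum_bounded:
  assumes "of_real x \<in> op_spectrum T"
  shows "\<bar>x\<bar> \<le> norm T"
proof (rule ccontr)
  assume "\<not> \<bar>x\<bar> \<le> norm T"
  then have x: "norm T < \<bar>x\<bar>" by simp
  then have "x \<noteq> 0" using norm_ge_zero[of T] by auto
  have "invertible_op (cscale_op (of_real (- x)) o\<^sub>L (T - cscale_op (of_real x)))"
  proof (rule coercive_invertible)
    show "0 < \<bar>x\<bar> * (\<bar>x\<bar> - norm T)" using x \<open>x \<noteq> 0\<close> by simp
    fix f
    have "\<bar>inner (T f) f\<bar> \<le> norm T * norm f * norm f"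
      using Cauchy_Schwarz_ineq2[of "T f" f] mult_right_mono[OF norm_blinfun[of T f], of "norm f"]
      by simp
    then have "\<bar>x\<bar> * \<bar>inner (T f) f\<bar> \<le> \<bar>x\<bar> * (norm T * (norm f)\<^sup>2)"
      by (intro mult_left_mono) (simp_all add: power2_eq_square mult.assoc)
    moreover have "x * inner (T f) f \<le> \<bar>x\<bar> * \<bar>inner (T f) f\<bar>"
      by (simp flip: abs_mult)
    ultimately have "x * inner (T f) f \<le> \<bar>x\<bar> * norm T * (norm f)\<^sup>2" by simp
    then have "\<bar>x\<bar> * (\<bar>x\<bar> - norm T) * (norm f)\<^sup>2 \<le> x * x * (norm f)\<^sup>2 - x * inner (T f) f"
      by (simp add: algebra_simps)
    then show "\<bar>x\<bar> * (\<bar>x\<bar> - norm T) * (norm f)\<^sup>2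
        \<le> inner ((cscale_op (of_real (- x)) o\<^sub>L (T - cscale_op (of_real x))) f) f"
      unfolding blinfun_apply_blinfun_compose cscale_op_apply cscale_of_real blinfun.diff_left
      by (simp add: inner_diff_left power2_norm_eq_inner algebra_simps)
  qed
  then have "invertible_op (T - cscale_op (of_real x))"
    by (rule invertible_op_cscale_cancel[rotated]) (use \<open>x \<noteq> 0\<close> in simp)
  then show False using assms by (simp add: op_spectrum_iff)
qed

text \<open>One half of spectral mapping. Over the complex numbers \<open>r\<close> splits into
  linear factors; if no root lay in the spectrum, every factor and hence \<open>r(T)\<close> would
  be invertible.\<close>

lemma op_poly_not_invertible_root:
  assumes "r \<noteq> 0" "\<not> invertible_op (op_poly r T)"
  shows "\<exists>z\<in>op_spectrum T. poly r z = 0"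
  using assms
proof (induction "degree r" arbitrary: r rule: less_induct)
  case less
  show ?case
  proof (cases "degree r = 0")
    case True
    then obtain c where c: "r = [:c:]" by (metis degree_eq_zeroE)
    then have "op_poly r T = cscale_op c"
      by (intro blinfun_eqI) (simp add: op_poly_pCons[OF sa])
    then show ?thesis using less.prems c invertible_cscale_op by auto
  next
    case False
    then obtain z where z: "poly r z = 0"
      using fundamental_theorem_of_algebra[of r] constant_degree[of r] by auto
    then obtain s where s: "r = [:- z, 1:] * s" by (metis dvd_def poly_eq_0_iff_dvd)
    show ?thesis
    proof (cases "z \<in> op_spectrum T")
      case False
      then have "\<not> invertible_op (op_poly s T)"
        using less.prems(2) invertible_op_compose
        by (auto simp: s op_poly_mult[OF sa] op_poly_linear[OF sa] op_spectrum_iff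
            simp del: mult_pCons_left)
      moreover have "s \<noteq> 0" using s less.prems(1) by auto
      moreover have "degree s < degree r"
        using \<open>s \<noteq> 0\<close> by (simp add: s degree_mult_eq del: mult_pCons_left)
      ultimately obtain y where "y \<in> op_spectrum T" "poly s y = 0"
        using less.hyps by blast
      then show ?thesis by (auto simp: s)
    qed (use z in blast)
  qed
qed

lemma op_poly_square_diff:
  "op_poly (p * p - [:of_real c:]) T = (op_poly p T o\<^sub>L op_poly p T) - c *\<^sub>R id_blinfun"
proof -
  have "op_poly [:of_real c:] T = c *\<^sub>R id_blinfun"
    by (rule blinfun_eqI) (simp add: op_poly_pCons[OF sa] cscale_of_real blinfun.scaleR_left)
  then show ?thesis by (simp add: op_poly_diff op_poly_mult[OF sa])
qed

lemma delta_nonzero: "delta u \<noteq> 0"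
  by (metis norm_delta norm_zero zero_neq_one)

text \<open>\<open>T\<^sup>2 - (norm T)\<^sup>2\<close> is not invertible, so the corresponding
  quadratic polynomial has a root in the spectrum.\<close>

lemma self_adjoint_spectrum_nonempty: "\<exists>x. complex_of_real x \<in> op_spectrum T"
proof -
  let ?p = "[:0, 1:] :: complex poly"
  let ?r = "?p * ?p - [:of_real ((norm T)\<^sup>2):]"
  have "op_poly ?p T = T"
    using op_poly_linear[OF sa, of 0] cscale_of_real[of 0]
    by (auto intro!: blinfun_eqI simp: blinfun.diff_left)
  then have "\<not> invertible_op (op_poly ?r T)"
    unfolding op_poly_square_diff
    using self_adjoint_norm_not_invertible[OF self_adjoint_op_inner[OF sa] delta_nonzero] by simp
  moreover have "?r \<noteq> 0" by simp
  ultimately obtain z where "z \<in> op_spectrum T"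
    using op_poly_not_invertible_root by blast
  then show ?thesis
    using self_adjoint_spectrum_real by (metis complex_is_Real_iff of_real_Re)
qed

text \<open>With \<open>q\<close> the product of \<open>p\<close> and its conjugate,
  \<open>Q = q(T)\<close> is self-adjoint, so \<open>q\<^sup>2 - (norm Q)\<^sup>2\<close> has a root
  in the spectrum. There the squared modulus of \<open>p\<close> equals \<open>norm Q\<close>,
  whence \<open>norm Q\<close> is at most \<open>M\<^sup>2\<close>. The bound for
  \<open>p(T)\<close> follows since the squared norm of \<open>p(T) f\<close> is the inner product
  of \<open>Q f\<close> and \<open>f\<close>.\<close>

theorem norm_op_poly_le:
  assumes M: "\<And>x. of_real x \<in> op_spectrum T \<Longrightarrow> cmod (poly p (of_real x)) \<le> M"
  shows "norm (op_poly p T) \<le> M"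
proof -
  let ?q = "map_poly cnj p * p"
  let ?Q = "op_poly ?q T"
  let ?r = "?q * ?q - [:of_real ((norm ?Q)\<^sup>2):]"
  have Q: "?Q = op_poly (map_poly cnj p) T o\<^sub>L op_poly p T"
    by (simp add: op_poly_mult[OF sa])
  have "0 \<le> M"
    using self_adjoint_spectrum_nonempty M by (meson norm_ge_zero order_trans)
  have "map_poly cnj ?q = ?q"
    by (rule poly_eq_poly_eq_iff[THEN iffD1]) (auto simp: mult.commute)
  then have "inner (?Q f) g = inner f (?Q g)" for f g
    using op_poly_adjoint[OF sa, of ?q f g] by simp
  then have "\<not> invertible_op (op_poly ?r T)"
    unfolding op_poly_square_diff by (intro self_adjoint_norm_not_invertible[OF _ delta_nonzero])
  then have "\<exists>z\<in>op_spectrum T. poly ?r z = 0"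
  proof (cases "?r = 0")
    \<comment> \<open>The zero polynomial escapes the factorisation, but every point of the nonempty
      spectrum is a root of it.\<close>
    case True
    then show ?thesis using self_adjoint_spectrum_nonempty by auto
  qed (rule op_poly_not_invertible_root)
  then obtain x where x: "of_real x \<in> op_spectrum T" "poly ?r (of_real x) = 0"
    using self_adjoint_spectrum_real by (metis complex_is_Real_iff of_real_Re)
  \<comment> \<open>At real arguments \<open>map_poly cnj p\<close> takes the conjugate values of
    \<open>p\<close>.\<close>
  have "poly ?q (of_real x) = of_real ((cmod (poly p (of_real x)))\<^sup>2)"
    by (simp add: mult.commute complex_norm_square flip: of_real_power)
  then have "((cmod (poly p (of_real x)))\<^sup>2)\<^sup>2 = (norm ?Q)\<^sup>2"
    using x(2) by (simp flip: of_real_mult add: power2_eq_square)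
  then have "norm ?Q = (cmod (poly p (of_real x)))\<^sup>2"
    by (metis norm_ge_zero power2_eq_imp_eq zero_le_power2)
  also have "\<dots> \<le> M\<^sup>2" using M[OF x(1)] by (intro power_mono) auto
  finally have QM: "norm ?Q \<le> M\<^sup>2" .
  show ?thesis
  proof (rule norm_blinfun_bound[OF \<open>0 \<le> M\<close>])
    fix f
    have "(norm (op_poly p T f))\<^sup>2 = inner (?Q f) f"
      unfolding Q by (simp add: power2_norm_eq_inner op_poly_adjoint[OF sa] inner_commute)
    also have "\<dots> \<le> norm (?Q f) * norm f" by (rule norm_cauchy_schwarz)
    also have "\<dots> \<le> (norm ?Q * norm f) * norm f"
      by (intro mult_right_mono norm_blinfun) auto
    also have "\<dots> \<le> (M * norm f)\<^sup>2"
      using mult_right_mono[OF QM, of "(norm f)\<^sup>2"] by (simp add: power2_eq_square mult_ac)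
    finally show "norm (op_poly p T f) \<le> M * norm f"
      by (rule power2_le_imp_le) (simp add: \<open>0 \<le> M\<close>)
  qed
qed

text \<open>Two sequences are allowed so that one estimate serves twice: \<open>q = p\<close> gives
  the Cauchy property, and different \<open>p\<close> and \<open>q\<close> give independence of the
  approximation.\<close>

lemma op_poly_Cauchy_diff:
  assumes p: "uniform_limit {x. of_real x \<in> op_spectrum T} (\<lambda>n x. poly (p n) (of_real x)) \<phi> sequentially"
    and q: "uniform_limit {x. of_real x \<in> op_spectrum T} (\<lambda>n x. poly (q n) (of_real x)) \<phi> sequentially"
    and "0 < e"
  shows "\<exists>N. \<forall>m\<ge>N. \<forall>n\<ge>N. norm (op_poly (p m) T - op_poly (q n) T) < e"
proof -
  let ?\<sigma> = "{x. complex_of_real x \<in> op_spectrum T}"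
  obtain N1 where N1: "\<And>n x. n \<ge> N1 \<Longrightarrow> x \<in> ?\<sigma> \<Longrightarrow> dist (poly (p n) (of_real x)) (\<phi> x) < e / 3"
    using uniform_limitD[OF p, of "e / 3"] \<open>0 < e\<close> unfolding eventually_sequentially by auto
  obtain N2 where N2: "\<And>n x. n \<ge> N2 \<Longrightarrow> x \<in> ?\<sigma> \<Longrightarrow> dist (poly (q n) (of_real x)) (\<phi> x) < e / 3"
    using uniform_limitD[OF q, of "e / 3"] \<open>0 < e\<close> unfolding eventually_sequentially by auto
  have "norm (op_poly (p m) T - op_poly (q n) T) < e" if "m \<ge> max N1 N2" "n \<ge> max N1 N2" for m n
  proof -
    have "norm (op_poly (p m - q n) T) \<le> e / 3 + e / 3"
    proof (rule norm_op_poly_le)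
      fix x assume "of_real x \<in> op_spectrum T"
      then have "dist (poly (p m) (of_real x)) (\<phi> x) < e / 3"
        "dist (poly (q n) (of_real x)) (\<phi> x) < e / 3"
        using that N1 N2 by auto
      then show "cmod (poly (p m - q n) (of_real x)) \<le> e / 3 + e / 3"
        using dist_triangle_less_add[of "poly (p m) (of_real x)" "\<phi> x" "e / 3"
            "poly (q n) (of_real x)" "e / 3"]
        by (simp add: dist_norm norm_minus_commute)
    qed
    then show ?thesis using \<open>0 < e\<close> by (simp add: op_poly_diff)
  qed
  then show ?thesis by blast
qed

text \<open>Completeness supplies a limit, and comparison with any other approximating sequence
  shows that it alone meets the description in \<open>op_fun\<close>.\<close>

theorem op_poly_tendsto_op_fun:
  assumes lim: "uniform_limit {x. of_real x \<in> op_spectrum T}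
      (\<lambda>n x. poly (p n) (of_real x)) \<phi> sequentially"
  shows "(\<lambda>n. op_poly (p n) T) \<longlonglongrightarrow> op_fun \<phi> T"
proof -
  have "Cauchy (\<lambda>n. op_poly (p n) T)"
    unfolding Cauchy_def dist_norm using op_poly_Cauchy_diff[OF lim lim] by blast
  then obtain S where S: "(\<lambda>n. op_poly (p n) T) \<longlonglongrightarrow> S"
    by (auto simp: Cauchy_convergent_iff convergent_def)
  have "op_fun \<phi> T = S"
    unfolding op_fun_def
  proof (rule the_equality)
    fix S' assume "\<exists>q. uniform_limit {x. of_real x \<in> op_spectrum T}
        (\<lambda>n x. poly (q n) (of_real x)) \<phi> sequentially \<and> (\<lambda>n. op_poly (q n) T) \<longlonglongrightarrow> S'"
    then obtain q where q: "uniform_limit {x. of_real x \<in> op_spectrum T}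
        (\<lambda>n x. poly (q n) (of_real x)) \<phi> sequentially" "(\<lambda>n. op_poly (q n) T) \<longlonglongrightarrow> S'"
      by blast
    have "(\<lambda>n. op_poly (q n) T - op_poly (p n) T) \<longlonglongrightarrow> 0"
      unfolding LIMSEQ_iff using op_poly_Cauchy_diff[OF q(1) lim] by fastforce
    then show "S' = S"
      using tendsto_diff[OF q(2) S] LIMSEQ_unique by fastforce
  qed (use lim S in blast)
  then show ?thesis using S by simp
qed

end

section \<open>Uniform polynomial approximation on an interval\<close>

lemma complex_polynomial_approximation:
  fixes \<phi> :: "real \<Rightarrow> complex"
  assumes "continuous_on {a..b} \<phi>" "0 < e"
  shows "\<exists>p. \<forall>x\<in>{a..b}. cmod (poly p (of_real x) - \<phi> x) < e"
proof -
  have approx: "\<exists>p. \<forall>x\<in>{a..b}. cmod (poly p (of_real x) - of_real (f x)) < e / 2"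
    if cont: "continuous_on {a..b} f" for f :: "real \<Rightarrow> real"
  proof -
    obtain g where g: "real_polynomial_function g" "\<And>x. x \<in> {a..b} \<Longrightarrow> \<bar>f x - g x\<bar> < e / 2"
      by (rule Stone_Weierstrass_real_polynomial_function[OF compact_Icc cont, of "e / 2"])
        (use \<open>0 < e\<close> in auto)
    obtain c n where "g = (\<lambda>x. \<Sum>i\<le>n. c i * x ^ i)"
      using g(1) real_polynomial_function_iff_sum by auto
    then have "poly (\<Sum>i\<le>n. monom (of_real (c i)) i) (of_real x) = complex_of_real (g x)" for x
      by (simp add: poly_sum poly_monom)
    moreover have "cmod (of_real (g x) - of_real (f x)) < e / 2" if "x \<in> {a..b}" for x
      using g(2)[OF that] unfolding of_real_diff[symmetric] norm_of_real by linarith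
    ultimately show ?thesis
      by (intro exI[of _ "\<Sum>i\<le>n. monom (of_real (c i)) i"]) simp
  qed
  obtain p q where
    p: "\<And>x. x \<in> {a..b} \<Longrightarrow> cmod (poly p (of_real x) - of_real (Re (\<phi> x))) < e / 2" and
    q: "\<And>x. x \<in> {a..b} \<Longrightarrow> cmod (poly q (of_real x) - of_real (Im (\<phi> x))) < e / 2"
    using approx[OF continuous_on_Re[OF assms(1)]] approx[OF continuous_on_Im[OF assms(1)]] by blast
  have "cmod (poly (p + smult \<i> q) (of_real x) - \<phi> x) < e" if "x \<in> {a..b}" for x
  proof -
    have "poly (p + smult \<i> q) (of_real x) - \<phi> x
        = (poly p (of_real x) - of_real (Re (\<phi> x))) + \<i> * (poly q (of_real x) - of_real (Im (\<phi> x)))"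
      using complex_eq[of "\<phi> x"] by (simp add: algebra_simps)
    also have "cmod \<dots> \<le> cmod (poly p (of_real x) - of_real (Re (\<phi> x)))
        + cmod (poly q (of_real x) - of_real (Im (\<phi> x)))"
      by (rule order_trans[OF norm_triangle_ineq]) (simp add: norm_mult)
    finally show ?thesis using p[OF that] q[OF that] by linarith
  qed
  then show ?thesis by blast
qed

text \<open>One sequence of polynomials, good on the interval from \<open>- R\<close> to
  \<open>R\<close>, serves all self-adjoint operators of norm at most \<open>R\<close>; this makes
  the two adjacency operators comparable term by term.\<close>

lemma op_fun_approximation:
  fixes \<phi> :: "real \<Rightarrow> complex"
  assumes "continuous_on UNIV \<phi>"
  obtains p where "\<And>T. self_adjoint_op T \<Longrightarrow> norm T \<le> R \<Longrightarrow> (\<lambda>n. op_poly (p n) T) \<longlonglongrightarrow> op_fun \<phi> T"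
proof -
  have "\<exists>p. \<forall>x\<in>{- R..R}. cmod (poly p (of_real x) - \<phi> x) < inverse (real (Suc n))" for n
    by (rule complex_polynomial_approximation) (auto intro: continuous_on_subset[OF assms])
  then obtain p where
    p: "\<And>n x. x \<in> {- R..R} \<Longrightarrow> cmod (poly (p n) (of_real x) - \<phi> x) < inverse (real (Suc n))"
    by metis
  have lim: "uniform_limit {- R..R} (\<lambda>n x. poly (p n) (of_real x)) \<phi> sequentially"
  proof (rule uniform_limitI)
    fix e :: real assume "0 < e"
    show "\<forall>\<^sub>F n in sequentially. \<forall>x\<in>{- R..R}. dist (poly (p n) (of_real x)) (\<phi> x) < e"
      using order_tendstoD(2)[OF LIMSEQ_inverse_real_of_nat \<open>0 < e\<close>]
      by eventually_elim (auto simp: dist_norm intro: less_trans[OF p])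
  qed
  show ?thesis
  proof (rule that[of p])
    fix T :: "'a operator" assume T: "self_adjoint_op T" "norm T \<le> R"
    have "{x. complex_of_real x \<in> op_spectrum T} \<subseteq> {- R..R}"
      using self_adjoint_spectrum_bounded[OF T(1)] T(2) by fastforce
    then show "(\<lambda>n. op_poly (p n) T) \<longlonglongrightarrow> op_fun \<phi> T"
      by (intro op_poly_tendsto_op_fun T(1) uniform_limit_on_subset[OF lim])
  qed
qed


section \<open>Adjacency operators\<close>

lemma nbrs_sym: "w \<in> nbrs G v \<longleftrightarrow> v \<in> nbrs G w"
  by (simp add: nbrs_def insert_commute)

lemma countable_bounded_graph_degree:
  assumes "countable_bounded_graph G"
  obtains d where "\<And>v. finite (nbrs G v)" "\<And>v. card (nbrs G v) \<le> d"
proof -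
  obtain d where d: "\<And>v. v \<in> verts G \<Longrightarrow> finite (nbrs G v) \<and> card (nbrs G v) \<le> d"
    using assms unfolding countable_bounded_graph_def bounded_degree_def by auto
  have "nbrs G v = {}" if "v \<notin> verts G" for v
    using assms that unfolding countable_bounded_graph_def simple_graph_def nbrs_def by auto
  then have "finite (nbrs G v) \<and> card (nbrs G v) \<le> d" for v
    using d[of v] by (cases "v \<in> verts G") auto
  then show ?thesis using that by blast
qed

lemma finite_nbrs: "countable_bounded_graph G \<Longrightarrow> finite (nbrs G v)"
  by (metis countable_bounded_graph_degree)

lemma adj_op_delta_nth:
  assumes "countable_bounded_graph G"
  shows "ell2_nth (adj_op G (delta v)) u = (if u \<in> nbrs G v then 1 else 0)"
  using finite_nbrs[OF assms, of u]
  by (simp add: adj_op_apply[OF assms] delta.rep_eq sum.delta' nbrs_sym[of u])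

lemma ell2_nth_sum: "ell2_nth (sum f A) v = (\<Sum>a\<in>A. ell2_nth (f a) v)"
  by (induction A rule: infinite_finite_induct) (simp_all add: zero_ell2.rep_eq plus_ell2.rep_eq)

lemma adj_op_delta:
  assumes "countable_bounded_graph G"
  shows "adj_op G (delta v) = (\<Sum>w\<in>nbrs G v. delta w)"
proof (rule ell2_eqI)
  fix u
  show "ell2_nth (adj_op G (delta v)) u = ell2_nth (\<Sum>w\<in>nbrs G v. delta w) u"
    using finite_nbrs[OF assms, of v]
    by (simp add: adj_op_delta_nth[OF assms] ell2_nth_sum delta.rep_eq)
qed

text \<open>Each term is repeated at most \<open>d\<close> times, \<open>d\<close> being a degree
  bound. The result provides the dominating function for exchanging sums over edges.\<close>

lemma summable_on_edges:
  assumes "countable_bounded_graph G" "(\<lambda>v. (cmod (f v))\<^sup>2) summable_on UNIV"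
  shows "(\<lambda>(v, w). if w \<in> nbrs G v then (cmod (f v))\<^sup>2 else 0) summable_on UNIV \<times> UNIV"
proof -
  obtain d where d: "\<And>v. finite (nbrs G v)" "\<And>v. card (nbrs G v) \<le> d"
    using countable_bounded_graph_degree[OF assms(1)] by blast
  show ?thesis
  proof (rule summable_on_SigmaI[where g = "\<lambda>v. real (card (nbrs G v)) * (cmod (f v))\<^sup>2"])
    fix v
    show "((\<lambda>w. (\<lambda>(v, w). if w \<in> nbrs G v then (cmod (f v))\<^sup>2 else 0) (v, w))
        has_sum real (card (nbrs G v)) * (cmod (f v))\<^sup>2) UNIV"
      by (rule has_sum_finite_neutralI[OF d(1)[of v]]) auto
  next
    show "(\<lambda>v. real (card (nbrs G v)) * (cmod (f v))\<^sup>2) summable_on UNIV"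
      by (rule summable_on_comparison_test[OF summable_on_cmult_right[OF assms(2), of "real d"]])
        (auto intro!: mult_right_mono simp: d)
  qed auto
qed

text \<open>Adjacency is symmetric, so the two sides are the two iterated sums of \<open>h\<close>
  over directed edges. They agree because \<open>h\<close> is dominated by the squares of
  \<open>f\<close> and \<open>g\<close> at the ends of the edge.\<close>

lemma self_adjoint_adj_op:
  assumes "countable_bounded_graph G"
  shows "self_adjoint_op (adj_op G)"
  unfolding self_adjoint_op_def
proof (intro allI)
  fix f g :: "'a ell2"
  define h where "h v w = (if w \<in> nbrs G v then cnj (ell2_nth f w) * ell2_nth g v else 0)" for v w
  have fin: "finite (nbrs G v)" for v using assms by (rule finite_nbrs)
  have sum_f: "(\<lambda>(v, w). if w \<in> nbrs G v then (cmod (ell2_nth f w))\<^sup>2 else 0) summable_on UNIV \<times> UNIV"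
    using summable_on_edges[OF assms, of "ell2_nth f"] ell2_nth[of f]
    by (subst summable_on_swap) (simp add: nbrs_sym[of _ G])
  have sum_g: "(\<lambda>(v, w). if w \<in> nbrs G v then (cmod (ell2_nth g v))\<^sup>2 else 0) summable_on UNIV \<times> UNIV"
    using summable_on_edges[OF assms, of "ell2_nth g"] ell2_nth[of g] by simp
  have "(\<lambda>(v, w). h v w) summable_on UNIV \<times> UNIV"
  proof (rule abs_summable_summable, rule Infinite_Sum.abs_summable_on_comparison_test')
    show "(\<lambda>x. (\<lambda>(v, w). if w \<in> nbrs G v then (cmod (ell2_nth f w))\<^sup>2 else 0) x
        + (\<lambda>(v, w). if w \<in> nbrs G v then (cmod (ell2_nth g v))\<^sup>2 else 0) x) summable_on UNIV \<times> UNIV"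
      by (rule summable_on_add[OF sum_f sum_g])
    have "cmod a * cmod b \<le> (cmod a)\<^sup>2 + (cmod b)\<^sup>2" for a b
      using sum_squares_bound[of "cmod a" "cmod b"] mult_nonneg_nonneg[of "cmod a" "cmod b"]
      by (simp del: mult_nonneg_nonneg)
    then show "norm (case x of (v, w) \<Rightarrow> h v w)
        \<le> (\<lambda>(v, w). if w \<in> nbrs G v then (cmod (ell2_nth f w))\<^sup>2 else 0) x
        + (\<lambda>(v, w). if w \<in> nbrs G v then (cmod (ell2_nth g v))\<^sup>2 else 0) x" for x
      by (auto simp: h_def norm_mult split: prod.split)
  qed
  then have swap: "(\<Sum>\<^sub>\<infinity>v. \<Sum>\<^sub>\<infinity>w. h v w) = (\<Sum>\<^sub>\<infinity>w. \<Sum>\<^sub>\<infinity>v. h v w)"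
    by (rule infsum_swap_banach)
  have "(\<Sum>\<^sub>\<infinity>w. h v w) = cnj (ell2_nth (adj_op G f) v) * ell2_nth g v" for v
    by (rule infsumI, rule has_sum_finite_neutralI[OF fin[of v]])
      (auto simp: h_def adj_op_apply[OF assms] sum_distrib_right)
  moreover have "(\<Sum>\<^sub>\<infinity>v. h v w) = cnj (ell2_nth f w) * ell2_nth (adj_op G g) w" for w
    by (rule infsumI, rule has_sum_finite_neutralI[OF fin[of w]])
      (auto simp: h_def adj_op_apply[OF assms] sum_distrib_left nbrs_sym[of w])
  ultimately show "cinner (adj_op G f) g = cinner f (adj_op G g)"
    using swap by (simp add: cinner.rep_eq)
qed


section \<open>Mean traces\<close>

lemma mean_trace_eq:
  assumes "finite (verts (K n))"
  shows "mean_trace K T n = (\<Sum>v\<in>verts (K n). ell2_nth (T (delta v)) v) / of_nat (card (verts (K n)))"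
proof -
  let ?P = "restrict_ell2 (verts (K n))"
  have "?P (delta v) = (if v \<in> verts (K n) then delta v else 0)" for v
    by (rule ell2_eqI) (auto simp: restrict_ell2.rep_eq delta.rep_eq zero_ell2.rep_eq)
  then have "op_trace (T o\<^sub>L proj_op (verts (K n))) = (\<Sum>v\<in>verts (K n). ell2_nth (T (delta v)) v)"
    unfolding op_trace_def using assms
    by (intro infsumI has_sum_finite_neutralI[of "verts (K n)"]) (auto simp: zero_ell2.rep_eq)
  then show ?thesis by (simp add: mean_trace_def)
qed

definition density_zero :: "(nat \<Rightarrow> 'v graph) \<Rightarrow> 'v set \<Rightarrow> bool" where
  "density_zero K S \<longleftrightarrow>
    (\<lambda>n. real (card (S \<inter> verts (K n))) / real (card (verts (K n)))) \<longlonglongrightarrow> 0"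

lemma tendsto_ratio_0_comparison:
  assumes "(\<lambda>n. f n / real (k n)) \<longlonglongrightarrow> 0" "\<And>n. norm (g n) \<le> f n"
  shows "(\<lambda>n. g n / of_nat (k n) :: 'a::real_normed_field) \<longlonglongrightarrow> 0"
proof (rule Lim_null_comparison[OF _ assms(1)])
  show "\<forall>\<^sub>F n in sequentially. norm (g n / of_nat (k n)) \<le> f n / real (k n)"
    using assms(2) by (intro always_eventually allI) (simp add: norm_divide divide_right_mono)
qed

context
  fixes K :: "nat \<Rightarrow> 'v graph"
  assumes fin: "\<And>n. finite (verts (K n))"
begin

lemma mean_trace_diff: "mean_trace K (S - T) n = mean_trace K S n - mean_trace K T n"
  by (simp add: mean_trace_eq fin blinfun.diff_left minus_ell2.rep_eq sum_subtractf
      diff_divide_distrib)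

lemma mean_trace_op_poly:
  "mean_trace K (op_poly p T) n = (\<Sum>k\<le>degree p. coeff p k * mean_trace K (op_power T k) n)"
  by (simp add: mean_trace_eq fin op_poly_apply[where n = "degree p"] ell2_nth_sum cscale.rep_eq
      sum_distrib_left[symmetric] sum_divide_distrib[symmetric] sum.swap[of _ _ "verts (K n)"])

text \<open>Only vertices with \<open>T (delta v)\<close> nonzero contribute, each at most
  \<open>norm T\<close>. This yields both the contraction property and the vanishing on
  perturbations of density zero.\<close>

lemma cmod_mean_trace_le_density:
  "cmod (mean_trace K T n)
    \<le> norm T * real (card ({v. T (delta v) \<noteq> 0} \<inter> verts (K n))) / real (card (verts (K n)))"
proof -
  have "cmod (\<Sum>v\<in>verts (K n). ell2_nth (T (delta v)) v)
      \<le> (\<Sum>v\<in>verts (K n). cmod (ell2_nth (T (delta v)) v))"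
    by (rule norm_sum)
  also have "\<dots> = (\<Sum>v\<in>{v. T (delta v) \<noteq> 0} \<inter> verts (K n). cmod (ell2_nth (T (delta v)) v))"
    using fin by (intro sum.mono_neutral_right) (auto simp: zero_ell2.rep_eq)
  also have "\<dots> \<le> (\<Sum>v\<in>{v. T (delta v) \<noteq> 0} \<inter> verts (K n). norm T)"
  proof (rule sum_mono)
    fix v
    show "cmod (ell2_nth (T (delta v)) v) \<le> norm T"
      using cmod_ell2_nth_le[of "T (delta v)" v] norm_blinfun[of T "delta v"] by simp
  qed
  finally show ?thesis
    by (simp add: mean_trace_eq fin norm_divide divide_right_mono mult.commute)
qed

lemma cmod_mean_trace_le: "cmod (mean_trace K T n) \<le> norm T"
proof -
  have "real (card ({v. T (delta v) \<noteq> 0} \<inter> verts (K n))) \<le> real (card (verts (K n)))"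
    using fin by (intro of_nat_mono card_mono) auto
  then have "norm T * (real (card ({v. T (delta v) \<noteq> 0} \<inter> verts (K n))) / real (card (verts (K n))))
      \<le> norm T * 1"
    by (intro mult_left_mono) (auto simp: divide_le_eq_1)
  then show ?thesis using cmod_mean_trace_le_density[of T n] by simp
qed

lemma mean_trace_diff_tendsto_0:
  fixes S T :: "'v operator"
  assumes "density_zero K {v. S (delta v) \<noteq> T (delta v)}"
  shows "(\<lambda>n. mean_trace K S n - mean_trace K T n) \<longlonglongrightarrow> 0"
proof -
  let ?B = "{v. (S - T) (delta v) \<noteq> 0}"
  have "(\<lambda>n. norm (S - T) * (real (card (?B \<inter> verts (K n))) / real (card (verts (K n))))) \<longlonglongrightarrow> 0"
    using tendsto_mult_left[OF assms[unfolded density_zero_def], of "norm (S - T)"]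
    by (simp add: blinfun.diff_left)
  moreover have "\<forall>\<^sub>F n in sequentially. norm (mean_trace K (S - T) n)
      \<le> norm (S - T) * (real (card (?B \<inter> verts (K n))) / real (card (verts (K n))))"
    using cmod_mean_trace_le_density[of "S - T"] by simp
  ultimately show ?thesis
    unfolding mean_trace_diff[symmetric] by (rule Lim_null_comparison[rotated])
qed

text \<open>The limits in \<open>j\<close> and \<open>n\<close> may be exchanged, since mean traces
  are contractions uniformly in \<open>n\<close>. The value \<open>L\<close> is determined by the
  numbers \<open>l j\<close> alone, so operators with the same \<open>l\<close> get the same
  trace.\<close>

lemma mean_trace_norm_limit:
  assumes T: "T \<longlonglongrightarrow> S" and l: "\<And>j. mean_trace K (T j) \<longlonglongrightarrow> l j"
  shows "\<exists>L. l \<longlonglongrightarrow> L \<and> mean_trace K S \<longlonglongrightarrow> L"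
proof -
  have close: "cmod (l i - l j) \<le> norm (T i - T j)" for i j
    using tendsto_diff[OF l[of i] l[of j]] cmod_mean_trace_le[of "T i - T j"]
    by (intro Lim_bounded[OF tendsto_norm]) (auto simp: mean_trace_diff)
  have "Cauchy l"
    unfolding Cauchy_def dist_norm
    using LIMSEQ_imp_Cauchy[OF T, unfolded Cauchy_def dist_norm] close by (meson le_less_trans)
  then obtain L where L: "l \<longlonglongrightarrow> L" by (auto simp: Cauchy_convergent_iff convergent_def)
  have "uniform_limit UNIV (\<lambda>j n. mean_trace K (T j) n) (\<lambda>n. mean_trace K S n) sequentially"
  proof (rule uniform_limitI)
    fix e :: real assume "0 < e"
    show "\<forall>\<^sub>F j in sequentially. \<forall>n\<in>UNIV. dist (mean_trace K (T j) n) (mean_trace K S n) < e"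
      using tendstoD[OF T \<open>0 < e\<close>]
    proof eventually_elim
      case (elim j)
      then show ?case
        using cmod_mean_trace_le[of "T j - S"]
        by (auto simp: dist_norm mean_trace_diff intro: le_less_trans)
    qed
  qed
  then have "mean_trace K S \<longlonglongrightarrow> L"
    by (intro swap_uniform_limit'[OF _ L]) (auto simp: l)
  then show ?thesis using L by blast
qed

section \<open>Stability of density zero under subsets, unions and neighbourhoods\<close>

lemma density_zero_subset: "density_zero K S \<Longrightarrow> R \<subseteq> S \<Longrightarrow> density_zero K R"
  unfolding density_zero_def
  by (erule tendsto_ratio_0_comparison) (auto intro!: card_mono simp: fin)

lemma density_zero_Un:
  assumes "density_zero K R" "density_zero K S"
  shows "density_zero K (R \<union> S)"
  unfolding density_zero_def
proof (rule tendsto_ratio_0_comparison)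
  show "(\<lambda>n. (real (card (R \<inter> verts (K n))) + real (card (S \<inter> verts (K n))))
      / real (card (verts (K n)))) \<longlonglongrightarrow> 0"
    using tendsto_add[OF assms[unfolded density_zero_def]] by (simp add: add_divide_distrib)
  fix n
  show "norm (real (card ((R \<union> S) \<inter> verts (K n))))
      \<le> real (card (R \<inter> verts (K n))) + real (card (S \<inter> verts (K n)))"
    using card_Un_le[of "R \<inter> verts (K n)" "S \<inter> verts (K n)"] by (simp add: Int_Un_distrib2)
qed

end


section \<open>Closed walks and sets of density zero\<close>

lemma
  assumes "amenable_exhaustion X K"
  shows amenable_exhaustion_finite: "finite (verts (K n))"
    and amenable_exhaustion_nonempty: "verts X \<noteq> {} \<Longrightarrow> \<forall>\<^sub>F n in sequentially. verts (K n) \<noteq> {}"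
    and amenable_exhaustion_frontier:
      "(\<lambda>n. real (card (frontier_in X (K n))) / real (card (verts (K n)))) \<longlonglongrightarrow> 0"
proof -
  show "finite (verts (K n))" for n using assms by (simp add: amenable_exhaustion_def)
  show "(\<lambda>n. real (card (frontier_in X (K n))) / real (card (verts (K n)))) \<longlonglongrightarrow> 0"
    using assms by (simp add: amenable_exhaustion_def)
  have mono: "verts (K n) \<subseteq> verts (K m)" if "n \<le> m" for n m
    using assms by (intro lift_Suc_mono_le[OF _ that]) (simp add: amenable_exhaustion_def subgraph_def)
  assume "verts X \<noteq> {}"
  moreover have "(\<Union>n. verts (K n)) = verts X" using assms by (simp add: amenable_exhaustion_def)
  ultimately obtain N where "verts (K N) \<noteq> {}" by blast
  then show "\<forall>\<^sub>F n in sequentially. verts (K n) \<noteq> {}"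
    using mono unfolding eventually_sequentially by blast
qed

lemma frontier_in_subset: "frontier_in X K \<subseteq> verts K"
  by (auto simp: frontier_in_def)

text \<open>The edge to \<open>w\<close> bounds the distance to the complement by 1; a walk of
  length 0 stays inside \<open>K\<close>, so the distance is not 0.\<close>

lemma frontier_inI:
  assumes "v \<in> verts K" "w \<in> verts X - verts K" "w \<in> nbrs X v"
  shows "v \<in> frontier_in X K"
proof -
  let ?R = "{(x, y). {x, y} \<in> edges X}"
  have "gdist X v w \<le> enat 1"
    unfolding gdist_def using assms(3) by (intro Inf_lower imageI) (simp add: nbrs_def)
  then have "gdist_set X v (verts X - verts K) \<le> 1"
    unfolding gdist_set_def using assms(2) by (simp add: INF_lower2 one_enat_def)
  moreover have "1 \<le> gdist X v u" if "u \<in> verts X - verts K" for u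
  proof -
    have "1 \<le> k" if "(v, u) \<in> ?R ^^ k" for k
      using that assms(1) \<open>u \<in> verts X - verts K\<close> by (cases k) auto
    then show ?thesis
      unfolding gdist_def by (intro Inf_greatest) (auto simp: one_enat_def)
  qed
  then have "1 \<le> gdist_set X v (verts X - verts K)"
    unfolding gdist_set_def by (rule INF_greatest)
  ultimately show ?thesis using assms(1) by (simp add: frontier_in_def)
qed

text \<open>A vertex of \<open>K n\<close> adjacent to \<open>S\<close> either has such a neighbour
  inside \<open>K n\<close>, which leaves at most \<open>d\<close> choices per point of
  \<open>S\<close>, or lies on the frontier, which has density zero.\<close>

lemma density_zero_nbrs:
  assumes X: "countable_bounded_graph X" "verts X = UNIV" "amenable_exhaustion X K"
    and S: "density_zero K S"
  shows "density_zero K {v. \<exists>w\<in>nbrs X v. w \<in> S}"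
proof -
  note fin = amenable_exhaustion_finite[OF X(3)]
  obtain d where d: "\<And>v. finite (nbrs X v)" "\<And>v. card (nbrs X v) \<le> d"
    using countable_bounded_graph_degree[OF X(1)] by blast
  have bound: "card ({v. \<exists>w\<in>nbrs X v. w \<in> S} \<inter> verts (K n))
      \<le> d * card (S \<inter> verts (K n)) + card (frontier_in X (K n))" for n
  proof -
    have "{v. \<exists>w\<in>nbrs X v. w \<in> S} \<inter> verts (K n)
        \<subseteq> (\<Union>w\<in>S \<inter> verts (K n). nbrs X w) \<union> frontier_in X (K n)"
      using frontier_inI[of _ "K n" _ X] X(2) nbrs_sym[of _ X] by blast
    then have "card ({v. \<exists>w\<in>nbrs X v. w \<in> S} \<inter> verts (K n))
        \<le> card ((\<Union>w\<in>S \<inter> verts (K n). nbrs X w) \<union> frontier_in X (K n))"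
      using fin d(1) finite_subset[OF frontier_in_subset fin] by (intro card_mono) auto
    also have "\<dots> \<le> card (\<Union>w\<in>S \<inter> verts (K n). nbrs X w) + card (frontier_in X (K n))"
      by (rule card_Un_le)
    also have "card (\<Union>w\<in>S \<inter> verts (K n). nbrs X w) \<le> (\<Sum>w\<in>S \<inter> verts (K n). card (nbrs X w))"
      using fin by (intro card_UN_le) auto
    also have "\<dots> \<le> d * card (S \<inter> verts (K n))"
      using sum_bounded_above[of "S \<inter> verts (K n)" "\<lambda>w. card (nbrs X w)" d] d(2)
      by (simp add: mult.commute)
    finally show ?thesis by simp
  qed
  show ?thesis
    unfolding density_zero_def
  proof (rule tendsto_ratio_0_comparison)
    show "(\<lambda>n. (real d * real (card (S \<inter> verts (K n))) + real (card (frontier_in X (K n))))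
        / real (card (verts (K n)))) \<longlonglongrightarrow> 0"
      using tendsto_add[OF tendsto_mult_left[OF S[unfolded density_zero_def], of "real d"]
          amenable_exhaustion_frontier[OF X(3)]]
      by (simp add: add_divide_distrib)
    show "norm (real (card ({v. \<exists>w\<in>nbrs X v. w \<in> S} \<inter> verts (K n))))
      \<le> real d * real (card (S \<inter> verts (K n))) + real (card (frontier_in X (K n)))" for n
      using bound[of n] by (simp flip: of_nat_mult of_nat_add)
  qed
qed

text \<open>The vertices from which a walk in \<open>X\<close> with fewer than \<open>k\<close> steps leads to \<open>D\<close>.\<close>

primrec spread :: "'v graph \<Rightarrow> 'v set \<Rightarrow> nat \<Rightarrow> 'v set" where
  "spread X D 0 = {}"
| "spread X D (Suc k) = D \<union> {v. \<exists>w\<in>nbrs X v. w \<in> spread X D k}"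

lemma density_zero_spread:
  assumes X: "countable_bounded_graph X" "verts X = UNIV" "amenable_exhaustion X K"
    and D: "density_zero K D"
  shows "density_zero K (spread X D k)"
proof (induction k)
  case 0
  then show ?case by (simp add: density_zero_def)
next
  case (Suc k)
  then show ?case
    using density_zero_Un[OF amenable_exhaustion_finite[OF X(3)] D density_zero_nbrs[OF X]] by simp
qed

text \<open>A closed walk of length \<open>k\<close> that avoids the vertices where \<open>X\<close> and \<open>Y\<close> have different
  neighbours is a walk in \<open>X\<close> if and only if it is a walk in \<open>Y\<close>.\<close>

lemma op_power_adj_op_eq:
  assumes X: "countable_bounded_graph X" and Y: "countable_bounded_graph Y"
    and "v \<notin> spread X {v. nbrs X v \<noteq> nbrs Y v} k"
  shows "op_power (adj_op X) k (delta v) = op_power (adj_op Y) k (delta v)"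
  using assms(3)
proof (induction k arbitrary: v)
  case (Suc k)
  then have eq: "nbrs Y v = nbrs X v"
    and IH: "\<And>w. w \<in> nbrs X v \<Longrightarrow>
      op_power (adj_op X) k (delta w) = op_power (adj_op Y) k (delta w)"
    by auto
  \<comment> \<open>Letting one factor act first peels off the step of the walk at \<open>v\<close>,
    where the neighbourhoods are known to agree.\<close>
  have "op_power (adj_op X) (Suc k) (delta v) = (\<Sum>w\<in>nbrs X v. op_power (adj_op X) k (delta w))"
    by (simp add: op_power_commute[symmetric] adj_op_delta[OF X] blinfun.sum_right)
  also have "\<dots> = (\<Sum>w\<in>nbrs Y v. op_power (adj_op Y) k (delta w))"
    unfolding eq by (rule sum.cong) (simp_all add: IH)
  also have "\<dots> = op_power (adj_op Y) (Suc k) (delta v)"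
    by (simp add: op_power_commute[symmetric] adj_op_delta[OF Y] blinfun.sum_right)
  finally show ?case .
qed simp

lemma mean_trace_op_power_diff:
  assumes X: "countable_bounded_graph X" "verts X = UNIV" "amenable_exhaustion X K"
    and Y: "countable_bounded_graph Y"
    and D: "density_zero K {v. nbrs X v \<noteq> nbrs Y v}"
  shows "(\<lambda>n. mean_trace K (op_power (adj_op X) k) n - mean_trace K (op_power (adj_op Y) k) n)
    \<longlonglongrightarrow> 0"
proof (rule mean_trace_diff_tendsto_0)
  show fin: "finite (verts (K n))" for n using X(3) by (rule amenable_exhaustion_finite)
  show "density_zero K {v. op_power (adj_op X) k (delta v) \<noteq> op_power (adj_op Y) k (delta v)}"
    using op_power_adj_op_eq[OF X(1) Y]
    by (intro density_zero_subset[OF fin density_zero_spread[OF X D, of k]]) blast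
qed


section \<open>Averages of invariant functions\<close>

lemma one_BijGroup_UNIV: "\<one>\<^bsub>BijGroup UNIV\<^esub> = id"
  by (simp add: BijGroup_def id_def restrict_def)

text \<open>On the whole type the restrictions built into \<open>BijGroup\<close> are vacuous, so
  its operations become ordinary composition and inverse.\<close>

lemma subgroup_BijGroup_UNIV:
  assumes "subgroup \<Gamma> (BijGroup UNIV)"
  shows "g \<in> \<Gamma> \<Longrightarrow> bij g" "id \<in> \<Gamma>" "g \<in> \<Gamma> \<Longrightarrow> h \<in> \<Gamma> \<Longrightarrow> g \<circ> h \<in> \<Gamma>"
    "g \<in> \<Gamma> \<Longrightarrow> inv_into UNIV g \<in> \<Gamma>"
proof -
  interpret subgroup \<Gamma> "BijGroup UNIV" by (rule assms)
  have car: "g \<in> Bij UNIV" if "g \<in> \<Gamma>" for g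
    using mem_carrier[OF that] by (simp add: BijGroup_def)
  then show bij: "bij g" if "g \<in> \<Gamma>" for g using that by (auto simp: Bij_def)
  show "id \<in> \<Gamma>" using one_closed by (simp add: one_BijGroup_UNIV)
  show "g \<circ> h \<in> \<Gamma>" if "g \<in> \<Gamma>" "h \<in> \<Gamma>"
    using m_closed[OF that] car that by (simp add: BijGroup_def compose_def comp_def restrict_def)
  show "inv_into UNIV g \<in> \<Gamma>" if "g \<in> \<Gamma>"
    using m_inv_closed[OF that] car[OF that] by (simp add: inv_BijGroup restrict_def)
qed

text \<open>All matrix entries are treated, not just the diagonal ones of interest, because the
  induction passes from \<open>w\<close> to its neighbours.\<close>

lemma adj_op_power_invariant:
  assumes X: "countable_bounded_graph X" and "verts X = UNIV" "g \<in> graph_automorphisms X"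
  shows "ell2_nth (op_power (adj_op X) k (delta (g v))) (g w)
    = ell2_nth (op_power (adj_op X) k (delta v)) w"
proof (induction k arbitrary: w)
  case 0
  have "inj g" using assms(2,3) by (auto simp: graph_automorphisms_def Bij_def bij_def)
  then show ?case by (simp add: delta.rep_eq inj_eq)
next
  case (Suc k)
  have "bij g" using assms(2,3) by (auto simp: graph_automorphisms_def Bij_def)
  have nbrs_iff: "g u \<in> nbrs X (g w) \<longleftrightarrow> u \<in> nbrs X w" for u
    using assms(2,3) by (simp add: graph_automorphisms_def nbrs_def)
  have "nbrs X (g w) = g ` nbrs X w"
  proof (intro equalityI subsetI)
    fix x assume "x \<in> nbrs X (g w)"
    moreover obtain u where "x = g u" using bij_is_surj[OF \<open>bij g\<close>] by blast
    ultimately show "x \<in> g ` nbrs X w" by (simp add: nbrs_iff)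
  qed (auto simp: nbrs_iff)
  moreover have "inj_on g (nbrs X w)"
    using bij_is_inj[OF \<open>bij g\<close>] by (rule inj_on_subset) simp
  ultimately show ?case
    by (simp add: adj_op_apply[OF X] sum.reindex Suc.IH)
qed

text \<open>The translates of \<open>F\<close> by \<open>E n\<close> are disjoint, and on each of
  them \<open>t\<close> minus its mean \<open>a\<close> over \<open>F\<close> sums to 0. What
  remains of \<open>K n\<close> lies in the frontier and is negligible because \<open>t\<close> is
  bounded.\<close>

lemma invariant_average_tendsto:
  fixes t :: "'v \<Rightarrow> complex"
  assumes X: "verts X = UNIV" and periodic: "amenable_periodic_graph X \<Gamma> F K"
    and inv: "\<And>g v. g \<in> \<Gamma> \<Longrightarrow> t (g v) = t v" and bound: "\<And>v. cmod (t v) \<le> c"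
  shows "(\<lambda>n. (\<Sum>v\<in>verts (K n). t v) / of_nat (card (verts (K n)))) \<longlonglongrightarrow> (\<Sum>x\<in>F. t x) / of_nat (card F)"
proof -
  let ?V = "\<lambda>n. verts (K n)"
  define orb where "orb v = {g v |g. g \<in> \<Gamma>}" for v
  note periodic' = periodic[unfolded amenable_periodic_graph_def X]
  have exh: "amenable_exhaustion X K" using periodic' by blast
  have sub: "subgroup \<Gamma> (BijGroup UNIV)" using periodic' by blast
  have free: "g = id" if "g \<in> \<Gamma>" "g v = v" for g v
  proof -
    have "\<forall>g\<in>\<Gamma>. \<forall>v\<in>UNIV. g v = v \<longrightarrow> g = \<one>\<^bsub>BijGroup UNIV\<^esub>"
      using periodic' by (elim conjE)
    from this[rule_format, OF that(1) UNIV_I that(2)] show ?thesis by (simp only: one_BijGroup_UNIV)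
  qed
  have fin_orb: "finite (range orb)" unfolding orb_def using periodic' by (elim conjE)
  have F: "\<exists>!x. x \<in> F \<and> x \<in> orb v" for v
  proof -
    have "\<forall>v\<in>UNIV. \<exists>!x. x \<in> F \<and> x \<in> orb v"
      unfolding orb_def using periodic' by (elim conjE)
    then show ?thesis by simp
  qed
  have "\<exists>E. \<forall>n. finite (E n) \<and> E n \<subseteq> \<Gamma> \<and>
      ?V n - frontier_in X (K n) \<subseteq> (\<Union>g\<in>E n. g ` F) \<and> (\<Union>g\<in>E n. g ` F) \<subseteq> ?V n"
    using periodic' by (elim conjE)
  then obtain E where E': "\<forall>n. finite (E n) \<and> E n \<subseteq> \<Gamma> \<and>
      ?V n - frontier_in X (K n) \<subseteq> (\<Union>g\<in>E n. g ` F) \<and> (\<Union>g\<in>E n. g ` F) \<subseteq> ?V n"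
    by (rule exE)
  note E = E'[THEN spec, THEN conjunct1] E'[THEN spec, THEN conjunct2, THEN conjunct1]
    E'[THEN spec, THEN conjunct2, THEN conjunct2, THEN conjunct1]
    E'[THEN spec, THEN conjunct2, THEN conjunct2, THEN conjunct2]
  note fin = amenable_exhaustion_finite[OF exh]
  have orb_refl: "v \<in> orb v" for v
    unfolding orb_def using subgroup_BijGroup_UNIV(2)[OF sub] by (intro CollectI exI[of _ id]) simp
  have F_inj: "x = y" if "x \<in> F" "y \<in> F" "y \<in> orb x" for x y
    using F[of x] that orb_refl[of x] by blast
  \<comment> \<open>Distinct points of \<open>F\<close> have distinct orbits, and there are finitely
    many orbits.\<close>
  have "finite F"
  proof (rule inj_on_finite[OF _ _ fin_orb])
    show "inj_on orb F"
    proof (rule inj_onI)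
      fix x y assume "x \<in> F" "y \<in> F" "orb x = orb y"
      then show "x = y" using F_inj orb_refl[of y] by blast
    qed
  qed auto
  have "F \<noteq> {}" using F by blast
  then have cardF: "of_nat (card F) \<noteq> (0 :: complex)" using \<open>finite F\<close> by simp
  \<comment> \<open>If \<open>g x = h y\<close>, the element \<open>?k\<close> takes
    \<open>x\<close> to \<open>y\<close>; both lie in \<open>F\<close>, so \<open>x = y\<close>, and
    freeness gives \<open>g = h\<close>.\<close>
  have inj: "inj_on (\<lambda>(g, x). g x) (E n \<times> F)" for n
  proof (rule inj_onI, clarify)
    fix g h x y assume gh: "g \<in> E n" "h \<in> E n" and xy: "x \<in> F" "y \<in> F" and eq: "g x = h y"
    let ?k = "inv_into UNIV h \<circ> g"
    have \<Gamma>: "g \<in> \<Gamma>" "h \<in> \<Gamma>" using gh E(2) by auto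
    then have k: "?k \<in> \<Gamma>" using subgroup_BijGroup_UNIV[OF sub] by blast
    have h: "bij h" using subgroup_BijGroup_UNIV(1)[OF sub \<Gamma>(2)] .
    then have kx: "?k x = y" using eq by (simp add: bij_is_inj)
    have "y \<in> orb x" unfolding orb_def using k kx[symmetric] by (intro CollectI exI[of _ ?k] conjI)
    with xy have "x = y" by (rule F_inj)
    then have "?k x = x" using kx by simp
    with k have "?k = id" by (rule free)
    then have "h \<circ> ?k = h" by simp
    then have "g = h"
      using h by (simp add: fun_eq_iff surj_f_inv_f bij_is_surj)
    then show "g = h \<and> x = y" using \<open>x = y\<close> by simp
  qed
  define a where "a = (\<Sum>x\<in>F. t x) / of_nat (card F)"
  have tiles: "(\<Sum>v\<in>(\<Union>g\<in>E n. g ` F). t v - a) = 0" for n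
  proof -
    have "(\<Union>g\<in>E n. g ` F) = (\<lambda>(g, x). g x) ` (E n \<times> F)" by auto
    then have "(\<Sum>v\<in>(\<Union>g\<in>E n. g ` F). t v - a) = (\<Sum>(g, x)\<in>E n \<times> F. t (g x) - a)"
      by (simp only: sum.reindex[OF inj]) (simp add: case_prod_beta)
    also have "\<dots> = (\<Sum>g\<in>E n. \<Sum>x\<in>F. t (g x) - a)"
      by (simp add: sum.cartesian_product)
    also have "\<dots> = (\<Sum>g\<in>E n. 0)"
    proof (rule sum.cong)
      fix g assume "g \<in> E n"
      then have "g \<in> \<Gamma>" using E(2) by blast
      then have "(\<Sum>x\<in>F. t (g x) - a) = (\<Sum>x\<in>F. t x) - of_nat (card F) * a"
        by (simp add: inv sum_subtractf)
      then show "(\<Sum>x\<in>F. t (g x) - a) = 0" using cardF by (simp add: a_def)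
    qed simp
    finally show ?thesis by simp
  qed
  have "(\<lambda>n. (\<Sum>v\<in>?V n. t v - a) / of_nat (card (?V n))) \<longlonglongrightarrow> 0"
  proof (rule tendsto_ratio_0_comparison)
    show "(\<lambda>n. (c + cmod a) * real (card (frontier_in X (K n))) / real (card (?V n))) \<longlonglongrightarrow> 0"
      using tendsto_mult_left[OF amenable_exhaustion_frontier[OF exh], of "c + cmod a"] by simp
    fix n
    let ?W = "\<Union>g\<in>E n. g ` F"
    have fin_fr: "finite (frontier_in X (K n))" using finite_subset[OF frontier_in_subset fin] .
    have "0 \<le> c" using bound[of undefined] by (rule order_trans[OF norm_ge_zero])
    have "(\<Sum>v\<in>?V n. t v - a) = (\<Sum>v\<in>?V n - ?W. t v - a)"
      using sum.subset_diff[OF E(4)[of n] fin, of "\<lambda>v. t v - a"] tiles[of n] by simp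
    also have "cmod \<dots> \<le> real (card (?V n - ?W)) * (c + cmod a)"
    proof (rule sum_norm_bound)
      show "cmod (t v - a) \<le> c + cmod a" for v
        using norm_triangle_ineq4[of "t v" a] bound[of v] by linarith
    qed
    also have "\<dots> \<le> real (card (frontier_in X (K n))) * (c + cmod a)"
      using E(3)[of n] fin_fr \<open>0 \<le> c\<close> by (intro mult_right_mono of_nat_mono card_mono) auto
    finally show "cmod (\<Sum>v\<in>?V n. t v - a) \<le> (c + cmod a) * real (card (frontier_in X (K n)))"
      by (simp add: mult.commute)
  qed
  then have "(\<lambda>n. (\<Sum>v\<in>?V n. t v - a) / of_nat (card (?V n)) + a) \<longlonglongrightarrow> 0 + a"
    by (intro tendsto_intros)
  \<comment> \<open>Adding \<open>a\<close> back uses \<open>card (?V n) > 0\<close>, which holds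
    eventually; for empty \<open>K n\<close> the quotient is 0 by convention.\<close>
  moreover have "\<forall>\<^sub>F n in sequentially. (\<Sum>v\<in>?V n. t v - a) / of_nat (card (?V n)) + a
      = (\<Sum>v\<in>?V n. t v) / of_nat (card (?V n))"
    using amenable_exhaustion_nonempty[OF exh, unfolded X, OF UNIV_not_empty]
  proof eventually_elim
    case (elim n)
    then have "of_nat (card (?V n)) \<noteq> (0 :: complex)" using fin by simp
    then show ?case by (simp add: sum_subtractf diff_divide_distrib)
  qed
  ultimately show ?thesis
    unfolding a_def by (simp add: tendsto_cong)
qed

lemma mean_trace_op_power_convergent:
  assumes X: "verts X = UNIV" and periodic: "amenable_periodic_graph X \<Gamma> F K"
  shows "convergent (mean_trace K (op_power (adj_op X) k))"
proof -
  let ?T = "op_power (adj_op X) k"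
  have cbg: "countable_bounded_graph X" and exh: "amenable_exhaustion X K"
    and aut: "\<Gamma> \<subseteq> graph_automorphisms X"
    using periodic by (simp_all add: amenable_periodic_graph_def)
  have "(\<lambda>n. (\<Sum>v\<in>verts (K n). ell2_nth (?T (delta v)) v) / of_nat (card (verts (K n))))
      \<longlonglongrightarrow> (\<Sum>x\<in>F. ell2_nth (?T (delta x)) x) / of_nat (card F)"
  proof (rule invariant_average_tendsto[OF X periodic])
    show "ell2_nth (?T (delta (g v))) (g v) = ell2_nth (?T (delta v)) v" if "g \<in> \<Gamma>" for g v
      using adj_op_power_invariant[OF cbg X] aut that by blast
    show "cmod (ell2_nth (?T (delta v)) v) \<le> norm ?T" for v
      using cmod_ell2_nth_le[of "?T (delta v)" v] norm_blinfun[of ?T "delta v"] by simp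
  qed
  moreover have "mean_trace K ?T
      = (\<lambda>n. (\<Sum>v\<in>verts (K n). ell2_nth (?T (delta v)) v) / of_nat (card (verts (K n))))"
    using mean_trace_eq[of K _ ?T] amenable_exhaustion_finite[OF exh] by blast
  ultimately show ?thesis unfolding convergent_def by auto
qed

theorem trace_op_fun_eq:
  assumes X: "verts X = UNIV" and periodic: "amenable_periodic_graph X \<Gamma> F K"
    and Y: "countable_bounded_graph Y"
    and D: "density_zero K {v. nbrs X v \<noteq> nbrs Y v}"
    and \<phi>: "continuous_on UNIV (\<phi> :: real \<Rightarrow> complex)"
  shows "\<exists>L. mean_trace K (op_fun \<phi> (adj_op X)) \<longlonglongrightarrow> L \<and> mean_trace K (op_fun \<phi> (adj_op Y)) \<longlonglongrightarrow> L"
proof -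
  have cbg: "countable_bounded_graph X" and exh: "amenable_exhaustion X K"
    using periodic by (simp_all add: amenable_periodic_graph_def)
  note fin = amenable_exhaustion_finite[OF exh]
  obtain p where p: "\<And>T :: 'a operator. self_adjoint_op T \<Longrightarrow>
      norm T \<le> max (norm (adj_op X)) (norm (adj_op Y)) \<Longrightarrow>
      (\<lambda>n. op_poly (p n) T) \<longlonglongrightarrow> op_fun \<phi> T"
    using op_fun_approximation[OF \<phi>] by blast
  have pX: "(\<lambda>n. op_poly (p n) (adj_op X)) \<longlonglongrightarrow> op_fun \<phi> (adj_op X)"
    and pY: "(\<lambda>n. op_poly (p n) (adj_op Y)) \<longlonglongrightarrow> op_fun \<phi> (adj_op Y)"
    by (auto intro!: p self_adjoint_adj_op cbg Y)
  obtain l where l: "\<And>k. mean_trace K (op_power (adj_op X) k) \<longlonglongrightarrow> l k"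
    using mean_trace_op_power_convergent[OF X periodic] unfolding convergent_def by metis
  have l': "mean_trace K (op_power (adj_op Y) k) \<longlonglongrightarrow> l k" for k
    using tendsto_diff[OF l[of k] mean_trace_op_power_diff[OF cbg X exh Y D, of k]] by simp
  \<comment> \<open>The powers have the same limits \<open>l k\<close> for both graphs, so
    \<open>?l j\<close> is the trace of the \<open>j\<close>-th polynomial in either operator. Both
    traces of \<open>op_fun\<close> are then limits of \<open>?l\<close>.\<close>
  let ?l = "\<lambda>j. \<Sum>k\<le>degree (p j). coeff (p j) k * l k"
  have tX: "mean_trace K (op_poly (p j) (adj_op X)) \<longlonglongrightarrow> ?l j" for j
    unfolding mean_trace_op_poly[OF fin] by (intro tendsto_intros l)
  obtain L where L: "?l \<longlonglongrightarrow> L" "mean_trace K (op_fun \<phi> (adj_op X)) \<longlonglongrightarrow> L"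
    using mean_trace_norm_limit[of K, OF fin pX tX] by blast
  have tY: "mean_trace K (op_poly (p j) (adj_op Y)) \<longlonglongrightarrow> ?l j" for j
    unfolding mean_trace_op_poly[OF fin] by (intro tendsto_intros l')
  obtain L' where L': "?l \<longlonglongrightarrow> L'" "mean_trace K (op_fun \<phi> (adj_op Y)) \<longlonglongrightarrow> L'"
    using mean_trace_norm_limit[of K, OF fin pY tY] by blast
  have "L' = L" using L'(1) L(1) by (rule LIMSEQ_unique)
  then show ?thesis using L(2) L'(2) by blast
qed


section \<open>Density zero perturbations\<close>

context
  fixes X Y :: "'v graph"
  assumes X: "countable_bounded_graph X" and Y: "countable_bounded_graph Y"
begin

lemma self_adjoint_diff_adj_op: "self_adjoint_op (adj_op X - adj_op Y)"
  using self_adjoint_adj_op[OF X] self_adjoint_adj_op[OF Y]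
  by (simp add: self_adjoint_op_def blinfun.diff_left cinner_diff_left cinner_diff_right)

text \<open>The column of the difference at \<open>v\<close> is 1 on neighbours in \<open>X\<close>
  only, -1 on neighbours in \<open>Y\<close> only, and 0 elsewhere. The second application repeats
  the signs, so each such neighbour counts 1.\<close>

lemma adj_op_diff_square_nth:
  "ell2_nth ((adj_op X - adj_op Y) ((adj_op X - adj_op Y) (delta v))) v
    = of_nat (card (sym_diff (nbrs X v) (nbrs Y v)))"
proof -
  let ?f = "(adj_op X - adj_op Y) (delta v)"
  have f: "ell2_nth ?f w = of_bool (w \<in> nbrs X v) - of_bool (w \<in> nbrs Y v)" for w
    by (simp add: blinfun.diff_left minus_ell2.rep_eq adj_op_delta_nth X Y)
  have fin: "finite (nbrs X v)" "finite (nbrs Y v)" using finite_nbrs[OF X] finite_nbrs[OF Y] by auto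
  have "ell2_nth ((adj_op X - adj_op Y) ?f) v
      = (\<Sum>w\<in>nbrs X v. ell2_nth ?f w) - (\<Sum>w\<in>nbrs Y v. ell2_nth ?f w)"
    by (simp add: blinfun.diff_left[of _ _ ?f] minus_ell2.rep_eq[of "adj_op X ?f"] adj_op_apply X Y)
  also have "(\<Sum>w\<in>nbrs X v. ell2_nth ?f w) = (\<Sum>w\<in>nbrs X v - nbrs Y v. 1)"
    using fin by (intro sum.mono_neutral_cong_right) (auto simp: f)
  also have "(\<Sum>w\<in>nbrs Y v. ell2_nth ?f w) = (\<Sum>w\<in>nbrs Y v - nbrs X v. - 1)"
    using fin by (intro sum.mono_neutral_cong_right) (auto simp: f)
  also have "(\<Sum>w\<in>nbrs X v - nbrs Y v. 1) - (\<Sum>w\<in>nbrs Y v - nbrs X v. - 1)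
      = (of_nat (card (sym_diff (nbrs X v) (nbrs Y v))) :: complex)"
    using fin by (subst card_Un_disjoint) auto
  finally show ?thesis .
qed

lemma density_zero_perturbation_iff:
  assumes fin: "\<And>n. finite (verts (K n))" and "verts Y = verts X"
  shows "density_zero_perturbation K X Y \<longleftrightarrow>
    (\<lambda>n. real (\<Sum>v\<in>verts (K n). card (sym_diff (nbrs X v) (nbrs Y v))) / real (card (verts (K n)))) \<longlonglongrightarrow> 0"
    (is "_ \<longleftrightarrow> ?s \<longlonglongrightarrow> 0")
proof -
  let ?D = "adj_op X - adj_op Y"
  \<comment> \<open>Self-adjointness makes the square positive, so being essentially zero reduces to
    the limit of its mean trace.\<close>
  have "cinner f (?D (?D f)) = cinner (?D f) (?D f)" for f
    using self_adjoint_diff_adj_op by (simp add: self_adjoint_op_def)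
  then have "positive_op (?D o\<^sub>L ?D)"
    by (simp add: positive_op_def cinner_self infsum_nonneg)
  moreover have "mean_trace K (?D o\<^sub>L ?D) = (\<lambda>n. of_real (?s n))"
    by (simp add: fun_eq_iff mean_trace_eq fin adj_op_diff_square_nth)
  ultimately show ?thesis
    using assms(2) self_adjoint_diff_adj_op tendsto_of_real_iff[of ?s 0 sequentially, where ?'a = complex]
    by (simp add: density_zero_perturbation_def ess_zero_def ess_zero_positive_def
        del: of_real_divide)
qed

end

text \<open>Each vertex \<open>v \<in> V\<close> lies on \<open>card (S v)\<close> of the edges, and each edge has at most two ends.\<close>

lemma card_edges_degree_sum:
  fixes V :: "'v set" and e :: "'v set set"
  defines "S \<equiv> \<lambda>v. {w. {v, w} \<in> e}" and "EV \<equiv> {{u, v} |u v. {u, v} \<in> e \<and> u \<in> V}"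
  assumes V: "finite V" and S: "\<And>v. finite (S v)"
  shows "card EV \<le> (\<Sum>v\<in>V. card (S v))" "(\<Sum>v\<in>V. card (S v)) \<le> 2 * card EV"
proof -
  have EV: "EV = (\<Union>v\<in>V. (\<lambda>w. {v, w}) ` S v)" by (auto simp: EV_def S_def)
  then have fin: "finite EV" using V S by auto
  show "card EV \<le> (\<Sum>v\<in>V. card (S v))"
    unfolding EV using card_image_le[OF S] by (intro order_trans[OF card_UN_le[OF V]] sum_mono)
  \<comment> \<open>For fixed \<open>v\<close> the map from \<open>w\<close> to
    \<open>{v, w}\<close> injects \<open>S v\<close> into the edges at \<open>v\<close>; the
    incidences are then counted edge by edge.\<close>
  have "(\<Sum>v\<in>V. card (S v)) \<le> (\<Sum>v\<in>V. card {x\<in>EV. v \<in> x})"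
  proof (rule sum_mono)
    fix v assume "v \<in> V"
    then show "card (S v) \<le> card {x\<in>EV. v \<in> x}"
      using fin by (intro card_inj_on_le[of "\<lambda>w. {v, w}"])
        (auto simp: EV_def S_def inj_on_def doubleton_eq_iff)
  qed
  also have "\<dots> = (\<Sum>v\<in>V. \<Sum>x\<in>{x\<in>EV. v \<in> x}. 1)" by simp
  also have "\<dots> = (\<Sum>x\<in>EV. \<Sum>v\<in>{v\<in>V. v \<in> x}. 1)" using V fin by (rule sum.swap_restrict)
  also have "\<dots> \<le> (\<Sum>x\<in>EV. 2)"
  proof (rule sum_mono)
    fix x assume "x \<in> EV"
    then obtain u v where "x = {u, v}" by (auto simp: EV_def)
    then have "card {v\<in>V. v \<in> x} \<le> card {u, v}" by (intro card_mono) auto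
    also have "\<dots> \<le> 2" by (simp add: card_insert_if)
    finally show "(\<Sum>v\<in>{v\<in>V. v \<in> x}. 1) \<le> (2 :: nat)" by simp
  qed
  finally show "(\<Sum>v\<in>V. card (S v)) \<le> 2 * card EV" by simp
qed

text \<open>The vertex set is the whole type \<^typ>\<open>'v\<close> (countable and infinite by the hypothesis on \<open>X\<close>),
  so that the operators act on the square-summable functions on the vertices.\<close>

theorem proposition2p7:
  fixes X Y :: "'v graph" and \<Gamma> :: "('v \<Rightarrow> 'v) set" and F :: "'v set" and K :: "nat \<Rightarrow> 'v graph"
  assumes "verts X = (UNIV :: 'v set)"
    and "amenable_periodic_graph X \<Gamma> F K"
    and "countable_bounded_graph Y"
    and "verts Y = verts X"
  shows "(density_zero_perturbation K X Y \<longleftrightarrow>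
      (\<lambda>n. real (card {{u, v} |u v. {u, v} \<in> sym_diff (edges X) (edges Y) \<and> u \<in> verts (K n)})
            / real (card (verts (K n)))) \<longlonglongrightarrow> 0) \<and>
    (density_zero_perturbation K X Y \<longrightarrow>
      (\<forall>\<phi> :: real \<Rightarrow> complex. continuous_on UNIV \<phi> \<longrightarrow>
         has_trace K (op_fun \<phi> (adj_op X)) \<and> has_trace K (op_fun \<phi> (adj_op Y)) \<and>
         trace_Gamma K (op_fun \<phi> (adj_op X)) = trace_Gamma K (op_fun \<phi> (adj_op Y))))"
proof -
  have X: "countable_bounded_graph X" and exh: "amenable_exhaustion X K"
    using assms(2) by (simp_all add: amenable_periodic_graph_def)
  note Y = assms(3) and fin = amenable_exhaustion_finite[OF exh]
  let ?S = "\<lambda>v. sym_diff (nbrs X v) (nbrs Y v)"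
  let ?e = "\<lambda>n. {{u, v} |u v. {u, v} \<in> sym_diff (edges X) (edges Y) \<and> u \<in> verts (K n)}"
  let ?s = "\<lambda>n. \<Sum>v\<in>verts (K n). card (?S v)"
  have fin_S: "finite (?S v)" for v using finite_nbrs[OF X] finite_nbrs[OF Y] by simp
  have S: "?S v = {w. {v, w} \<in> sym_diff (edges X) (edges Y)}" for v by (auto simp: nbrs_def)
  have e_le: "card (?e n) \<le> ?s n" and s_le: "?s n \<le> 2 * card (?e n)" for n
    using card_edges_degree_sum[OF fin fin_S[unfolded S], of n] unfolding S by blast+
  have perturbation_iff: "density_zero_perturbation K X Y \<longleftrightarrow>
      (\<lambda>n. real (?s n) / real (card (verts (K n)))) \<longlonglongrightarrow> 0"
    by (rule density_zero_perturbation_iff[OF X Y fin assms(4)])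
  have "(\<lambda>n. real (?s n) / real (card (verts (K n)))) \<longlonglongrightarrow> 0 \<longleftrightarrow>
      (\<lambda>n. real (card (?e n)) / real (card (verts (K n)))) \<longlonglongrightarrow> 0"
  proof
    assume "(\<lambda>n. real (?s n) / real (card (verts (K n)))) \<longlonglongrightarrow> 0"
    then show "(\<lambda>n. real (card (?e n)) / real (card (verts (K n)))) \<longlonglongrightarrow> 0"
      by (rule tendsto_ratio_0_comparison) (use e_le in \<open>simp del: of_nat_sum\<close>)
  next
    assume "(\<lambda>n. real (card (?e n)) / real (card (verts (K n)))) \<longlonglongrightarrow> 0"
    from tendsto_mult_left[OF this, of 2]
    have "(\<lambda>n. real (2 * card (?e n)) / real (card (verts (K n)))) \<longlonglongrightarrow> 0" by simp
    then show "(\<lambda>n. real (?s n) / real (card (verts (K n)))) \<longlonglongrightarrow> 0"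
      by (rule tendsto_ratio_0_comparison) (use s_le in \<open>simp del: of_nat_sum of_nat_mult\<close>)
  qed
  moreover have "has_trace K (op_fun \<phi> (adj_op X)) \<and> has_trace K (op_fun \<phi> (adj_op Y)) \<and>
      trace_Gamma K (op_fun \<phi> (adj_op X)) = trace_Gamma K (op_fun \<phi> (adj_op Y))"
    if pert: "density_zero_perturbation K X Y" and \<phi>: "continuous_on UNIV \<phi>"
    for \<phi> :: "real \<Rightarrow> complex"
  proof -
    \<comment> \<open>Every vertex with differing neighbourhoods contributes at least 1 to
      \<open>?s n\<close>.\<close>
    have "density_zero K {v. nbrs X v \<noteq> nbrs Y v}"
      unfolding density_zero_def
    proof (rule tendsto_ratio_0_comparison[OF pert[unfolded perturbation_iff]])
      fix n
      let ?B = "{v. nbrs X v \<noteq> nbrs Y v} \<inter> verts (K n)"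
      have "card ?B = (\<Sum>v\<in>?B. 1)" by simp
      also have "\<dots> \<le> (\<Sum>v\<in>?B. card (?S v))"
      proof (rule sum_mono)
        fix v assume "v \<in> ?B"
        then have "?S v \<noteq> {}" by blast
        then show "1 \<le> card (?S v)" using fin_S[of v] by (simp add: Suc_le_eq card_gt_0_iff)
      qed
      also have "\<dots> \<le> ?s n" using fin by (intro sum_mono2) auto
      finally show "norm (real (card ?B)) \<le> real (?s n)" by (simp del: of_nat_sum)
    qed
    then obtain L where "mean_trace K (op_fun \<phi> (adj_op X)) \<longlonglongrightarrow> L"
      "mean_trace K (op_fun \<phi> (adj_op Y)) \<longlonglongrightarrow> L"
      using trace_op_fun_eq[OF assms(1,2) Y _ \<phi>] by blast
    then show ?thesis
      by (auto simp: has_trace_def trace_Gamma_def convergent_def limI)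
  qed
  ultimately show ?thesis using perturbation_iff by simp
qed

end
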